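(* For every $N \in \mathbb{N}$ there exists a right-angled Artin group $A_\Gamma$ such that $|\mathrm{Out}(\mathrm{Out}(A_\Gamma))| > N$.
   Context: For a finite simplicial graph $\Gamma=(V,E)$, the right-angled Artin group $A_\Gamma$ is the group with presentation $\langle v\in V \mid [v,w]=1 \text{ whenever } (v,w)\in E\rangle$. For a group $G$, $\mathrm{Out}(G)=\mathrm{Aut}(G)/\mathrm{Inn}(G)$. *)

theory Defs
  imports "HOL-Algebra.Algebra"
begin

text \<open>Words over the generators V and their inverses: a letter (v, True) stands for v,
  (v, False) for its inverse.\<close>

type_synonym 'v raag_word = "('v \<times> bool) list"

definition raag_words :: "'v set \<Rightarrow> 'v raag_word set" where
  "raag_words V = lists (V \<times> UNIV)"

inductive raag_eq :: "'v set \<Rightarrow> ('v \<Rightarrow> 'v \<Rightarrow> bool) \<Rightarrow> 'v raag_word \<Rightarrow> 'v raag_word \<Rightarrow> bool"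
  for V E where
  refl: "w \<in> raag_words V \<Longrightarrow> raag_eq V E w w"
| sym: "raag_eq V E u w \<Longrightarrow> raag_eq V E w u"
| trans: "raag_eq V E u w \<Longrightarrow> raag_eq V E w z \<Longrightarrow> raag_eq V E u z"
| cancel: "xs \<in> raag_words V \<Longrightarrow> ys \<in> raag_words V \<Longrightarrow> v \<in> V \<Longrightarrow>
     raag_eq V E (xs @ [(v, b), (v, \<not> b)] @ ys) (xs @ ys)"
| commute: "xs \<in> raag_words V \<Longrightarrow> ys \<in> raag_words V \<Longrightarrow> v \<in> V \<Longrightarrow> w \<in> V \<Longrightarrow> E v w \<Longrightarrow>
     raag_eq V E (xs @ [(v, b), (w, c)] @ ys) (xs @ [(w, c), (v, b)] @ ys)"

definition raag_class :: "'v set \<Rightarrow> ('v \<Rightarrow> 'v \<Rightarrow> bool) \<Rightarrow> 'v raag_word \<Rightarrow> 'v raag_word set" where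
  "raag_class V E w = {u. raag_eq V E w u}"

definition RAAG :: "'v set \<Rightarrow> ('v \<Rightarrow> 'v \<Rightarrow> bool) \<Rightarrow> 'v raag_word set monoid" where
  "RAAG V E =
    \<lparr>carrier = raag_class V E ` raag_words V,
     monoid.mult = (\<lambda>A B. {c. \<exists>a\<in>A. \<exists>b\<in>B. raag_eq V E (a @ b) c}),
     monoid.one = raag_class V E []\<rparr>"

definition simplicial_graph :: "'v set \<Rightarrow> ('v \<Rightarrow> 'v \<Rightarrow> bool) \<Rightarrow> bool" where
  "simplicial_graph V E \<longleftrightarrow> finite V \<and>
     (\<forall>v w. E v w \<longrightarrow> v \<in> V \<and> w \<in> V \<and> v \<noteq> w \<and> E w v)"

definition inner_auts :: "('a, 'c) monoid_scheme \<Rightarrow> ('a \<Rightarrow> 'a) set" where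
  "inner_auts G = (\<lambda>g. \<lambda>x\<in>carrier G. g \<otimes>\<^bsub>G\<^esub> x \<otimes>\<^bsub>G\<^esub> inv\<^bsub>G\<^esub> g) ` carrier G"

definition OutGroup :: "('a, 'c) monoid_scheme \<Rightarrow> ('a \<Rightarrow> 'a) set monoid" where
  "OutGroup G = AutoGroup G Mod inner_auts G"

end

theory Submission
  imports Defs
begin

text \<open>Let \<open>A = \<int> \<times> F\<^sub>3 \<times> F\<^sub>4 \<times> \<dots>\<close> with \<open>N + 2\<close> free factors of different ranks, and let \<open>t\<close> generate the
  centre \<open>\<int>\<close>. An automorphism \<open>\<alpha>\<close> maps \<open>t\<close> to \<open>t\<^sup>\<plusminus>\<^sup>1\<close>, and on the abelianization modulo \<open>t\<close> it
  preserves every free factor, since commuting elements have proportional components in the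
  abelianization of a free group and the ranks differ. A choice of signs \<open>c\<close>, one for each factor,
  therefore commutes with this action, and replacing \<open>\<alpha>\<close> by \<open>a \<mapsto> \<alpha>(a) t\<^bsup>h(c a - a)\<^esup>\<close>, where
  \<open>h(a)\<close> is the exponent of \<open>t\<close> in \<open>\<alpha>(a)\<close>, is an automorphism of \<open>Aut A\<close> that fixes the inner
  automorphisms. If it induced conjugation by \<open>g\<close> on \<open>Out A\<close>, then comparing transvections
  \<open>a \<mapsto> a t\<^bsup>e(a)\<^esup>\<close> shows that \<open>g\<close> acts on the abelianizations of the free factors as \<open>c\<close> or \<open>- c\<close>,
  whereas a \<open>g\<close> that acts as \<open>-1\<close> on one of them does not commute with partial conjugations in
  \<open>Out A\<close>. Hence the signs are determined up to a common factor.\<close>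

section \<open>Lower bounds for outer automorphism groups\<close>

lemma carrier_AutoGroup [simp]: "carrier (AutoGroup G) = auto G"
  by (simp add: AutoGroup_def)

lemma mult_AutoGroup [simp]:
  "f \<in> auto G \<Longrightarrow> g \<in> auto G \<Longrightarrow> f \<otimes>\<^bsub>AutoGroup G\<^esub> g = compose (carrier G) f g"
  by (simp add: AutoGroup_def BijGroup_def auto_def)

lemma autoD:
  assumes "f \<in> auto G"
  shows "f \<in> hom G G" "f \<in> extensional (carrier G)" "bij_betw f (carrier G) (carrier G)"
  using assms by (auto simp: auto_def Bij_def)

lemma auto_closed: "f \<in> auto G \<Longrightarrow> x \<in> carrier G \<Longrightarrow> f x \<in> carrier G"
  by (meson autoD(1) hom_in_carrier)

lemma auto_mult:
  "f \<in> auto G \<Longrightarrow> x \<in> carrier G \<Longrightarrow> y \<in> carrier G \<Longrightarrow> f (x \<otimes>\<^bsub>G\<^esub> y) = f x \<otimes>\<^bsub>G\<^esub> f y"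
  by (meson autoD(1) hom_mult)

lemma autoI:
  assumes "f \<in> hom G G" "f \<in> extensional (carrier G)" "g \<in> carrier G \<rightarrow> carrier G"
    and "\<And>x. x \<in> carrier G \<Longrightarrow> f (g x) = x" "\<And>x. x \<in> carrier G \<Longrightarrow> g (f x) = x"
  shows "f \<in> auto G"
  using assms by (auto simp: auto_def Bij_def hom_def intro!: bij_betw_byWitness[where f' = g])

section \<open>Inner automorphisms\<close>

context group
begin

definition conj_by :: "'a \<Rightarrow> 'a \<Rightarrow> 'a"
  where "conj_by g = (\<lambda>x\<in>carrier G. g \<otimes> x \<otimes> inv g)"

lemma inner_auts_eq: "inner_auts G = conj_by ` carrier G"
  by (simp add: inner_auts_def conj_by_def)

lemma inv_cancel [simp]:
  assumes "x \<in> carrier G" "y \<in> carrier G"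
  shows "inv x \<otimes> (x \<otimes> y) = y" "x \<otimes> (inv x \<otimes> y) = y"
  using assms by (simp_all flip: m_assoc)

lemma conj_by_compose:
  "g \<in> carrier G \<Longrightarrow> h \<in> carrier G \<Longrightarrow>
   conj_by (g \<otimes> h) = compose (carrier G) (conj_by g) (conj_by h)"
  by (auto simp: conj_by_def compose_def fun_eq_iff m_assoc inv_mult_group)

lemma conj_by_auto:
  assumes g: "g \<in> carrier G"
  shows "conj_by g \<in> auto G"
proof (rule autoI)
  show "conj_by g \<in> hom G G"
    using g by (auto simp: hom_def conj_by_def m_assoc)
  show "conj_by (inv g) \<in> carrier G \<rightarrow> carrier G"
    using g by (auto simp: conj_by_def)
qed (use g in \<open>auto simp: conj_by_def m_assoc\<close>)

lemma conj_by_hom: "group_hom G (AutoGroup G) conj_by"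
  by (intro group_hom.intro group_hom_axioms.intro is_group AutoGroup)
    (auto simp: hom_def conj_by_auto conj_by_compose)

lemma inner_auts_normal: "inner_auts G \<lhd> AutoGroup G"
proof -
  interpret A: group "AutoGroup G" by (rule AutoGroup)
  interpret c: group_hom G "AutoGroup G" conj_by by (rule conj_by_hom)
  have "f \<otimes>\<^bsub>AutoGroup G\<^esub> h \<otimes>\<^bsub>AutoGroup G\<^esub> inv\<^bsub>AutoGroup G\<^esub> f \<in> inner_auts G"
    if f: "f \<in> auto G" and "h \<in> inner_auts G" for f h
  proof -
    from \<open>h \<in> inner_auts G\<close> obtain g where g: "g \<in> carrier G" and h: "h = conj_by g"
      by (auto simp: inner_auts_eq)
    interpret f: group_hom G G f
      by (intro group_hom.intro group_hom_axioms.intro is_group autoD(1)[OF f])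
    have "f \<otimes>\<^bsub>AutoGroup G\<^esub> h = conj_by (f g) \<otimes>\<^bsub>AutoGroup G\<^esub> f"
      using f g unfolding h
      by (subst (1 2) mult_AutoGroup)
        (simp_all add: conj_by_auto, auto simp: compose_def conj_by_def fun_eq_iff auto_closed)
    hence "f \<otimes>\<^bsub>AutoGroup G\<^esub> h \<otimes>\<^bsub>AutoGroup G\<^esub> inv\<^bsub>AutoGroup G\<^esub> f = conj_by (f g)"
      using f c.hom_closed[OF f.hom_closed[OF g]]
      by (simp add: A.m_assoc del: mult_AutoGroup carrier_AutoGroup flip: carrier_AutoGroup)
    thus ?thesis using g by (simp add: inner_auts_eq)
  qed
  thus ?thesis
    using c.img_is_subgroup by (intro A.normal_invI) (simp_all add: inner_auts_eq del: mult_AutoGroup)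
qed

lemma auto_inverse:
  assumes f: "f \<in> auto G"
  obtains g where "g \<in> auto G" "\<And>a. a \<in> carrier G \<Longrightarrow> f (g a) = a" "\<And>a. a \<in> carrier G \<Longrightarrow> g (f a) = a"
proof -
  let ?g = "restrict (inv_into (carrier G) f) (carrier G)"
  have bij: "bij_betw f (carrier G) (carrier G)" and B: "f \<in> Bij (carrier G)"
    using f by (auto simp: auto_def Bij_def)
  have "?g \<in> auto G"
    using f restrict_inv_into_hom restrict_inv_into_Bij[OF B] by (auto simp: auto_def)
  moreover have "f (?g a) = a" "?g (f a) = a" if "a \<in> carrier G" for a
    using that bij auto_closed[OF f that]
    by (auto simp: bij_betw_def f_inv_into_f inv_into_f_f)
  ultimately show ?thesis by (rule that)
qed

end

section \<open>Automorphisms induced on a quotient group\<close>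

context normal
begin

lemma image_coset:
  assumes "\<Phi> \<in> hom G G" "\<Phi> ` H = H" "a \<in> carrier G"
  shows "\<Phi> ` (H #> a) = H #> \<Phi> a"
proof -
  have "\<Phi> ` (H #> a) = (\<lambda>h. \<Phi> (h \<otimes> a)) ` H"
    by (auto simp: r_coset_def)
  also have "\<dots> = (\<lambda>h. \<Phi> h \<otimes> \<Phi> a) ` H"
    using assms(3) mem_carrier by (intro image_cong refl hom_mult[OF assms(1)]) auto
  also have "\<dots> = (\<lambda>h. h \<otimes> \<Phi> a) ` (\<Phi> ` H)"
    by (simp only: image_image)
  also have "\<dots> = H #> \<Phi> a"
    unfolding assms(2) by (auto simp: r_coset_def)
  finally show ?thesis .
qed

text \<open>Cosets are subsets of \<open>G\<close>, so an injective \<open>\<Phi>\<close> has an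
  injective direct image on them; since \<open>\<Phi>\<close> maps \<open>H\<close> onto itself,
  cosets go to cosets.\<close>

lemma auto_FactGroup:
  assumes hom: "\<Phi> \<in> hom G G" and bij: "bij_betw \<Phi> (carrier G) (carrier G)" and H: "\<Phi> ` H = H"
  shows "(\<lambda>C\<in>carrier (G Mod H). \<Phi> ` C) \<in> auto (G Mod H)"
proof -
  have closed: "\<Phi> a \<in> carrier G" if "a \<in> carrier G" for a
    using hom that by (auto simp: hom_def)
  have mult: "\<Phi> (a \<otimes> b) = \<Phi> a \<otimes> \<Phi> b" if "a \<in> carrier G" "b \<in> carrier G" for a b
    using hom that by (auto simp: hom_def)
  have car: "carrier (G Mod H) = (\<lambda>x. H #> x) ` carrier G"
    by (rule carrier_FactGroup)
  have "inj_on ((`) \<Phi>) (carrier (G Mod H))"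
  proof (rule inj_onI)
    fix C D assume CD: "C \<in> carrier (G Mod H)" "D \<in> carrier (G Mod H)" "\<Phi> ` C = \<Phi> ` D"
    have "C \<subseteq> carrier G" "D \<subseteq> carrier G"
      using CD subset by (auto simp: car r_coset_def)
    thus "C = D"
      using CD bij by (metis bij_betw_def inj_on_image_eq_iff)
  qed
  moreover have "(`) \<Phi> ` carrier (G Mod H) = carrier (G Mod H)"
  proof -
    have "(`) \<Phi> ` carrier (G Mod H) = (\<lambda>a. H #> \<Phi> a) ` carrier G"
      by (simp add: car image_image image_coset[OF hom H] cong: image_cong)
    also have "\<dots> = (\<lambda>a. H #> a) ` (\<Phi> ` carrier G)"
      by (simp add: image_image)
    finally show ?thesis
      using bij by (simp add: car bij_betw_def)
  qed
  ultimately have "bij_betw ((`) \<Phi>) (carrier (G Mod H)) (carrier (G Mod H))"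
    by (simp add: bij_betw_def)
  moreover have "(`) \<Phi> \<in> hom (G Mod H) (G Mod H)"
  proof (rule homI)
    fix C D assume "C \<in> carrier (G Mod H)" "D \<in> carrier (G Mod H)"
    then obtain a b where ab: "a \<in> carrier G" "b \<in> carrier G" "C = H #> a" "D = H #> b"
      by (auto simp: car)
    show "\<Phi> ` C \<in> carrier (G Mod H)"
      using ab image_coset[OF hom H] closed by (simp add: car)
    show "\<Phi> ` (C \<otimes>\<^bsub>G Mod H\<^esub> D) = \<Phi> ` C \<otimes>\<^bsub>G Mod H\<^esub> \<Phi> ` D"
      using ab image_coset[OF hom H] closed by (simp add: rcos_sum mult)
  qed
  moreover have "C <#> D \<in> carrier (G Mod H)"
    if "C \<in> carrier (G Mod H)" "D \<in> carrier (G Mod H)" for C D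
    using that by (auto simp: car rcos_sum)
  ultimately show ?thesis
    by (simp add: auto_def Bij_def hom_def Pi_iff bij_betw_restrict_eq)
qed

end

text \<open>An automorphism of \<open>Aut G\<close> that fixes all inner automorphisms descends to \<open>Out G\<close>. Two of
  these, \<open>\<Phi>\<close> and \<open>\<Psi>\<close>, agree in \<open>Out (Out G)\<close> only if some \<open>g \<in> Aut G\<close> satisfies
  \<open>\<Phi> f \<equiv> g \<Psi> f g\<inverse>\<close> modulo inner automorphisms for all \<open>f\<close>; the condition below spells this out
  pointwise.\<close>

proposition (in group) OutGroup_OutGroup_large:
  fixes \<Phi> :: "'k \<Rightarrow> ('a \<Rightarrow> 'a) \<Rightarrow> 'a \<Rightarrow> 'a"
  assumes hom: "\<And>k. k \<in> K \<Longrightarrow> \<Phi> k \<in> hom (AutoGroup G) (AutoGroup G)"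
    and bij: "\<And>k. k \<in> K \<Longrightarrow> bij_betw (\<Phi> k) (auto G) (auto G)"
    and inner: "\<And>k f. k \<in> K \<Longrightarrow> f \<in> inner_auts G \<Longrightarrow> \<Phi> k f = f"
    and sep: "\<And>k l g. k \<in> K \<Longrightarrow> l \<in> K \<Longrightarrow> g \<in> auto G \<Longrightarrow>
       (\<And>f. f \<in> auto G \<Longrightarrow> \<exists>w\<in>carrier G. \<forall>x\<in>carrier G.
          \<Phi> k f (g x) = w \<otimes> g (\<Phi> l f x) \<otimes> inv w) \<Longrightarrow> k = l"
  shows "infinite (carrier (OutGroup (OutGroup G))) \<or>
    card K \<le> card (carrier (OutGroup (OutGroup G)))"
proof -
  let ?H = "inner_auts G"
  interpret A: group "AutoGroup G" by (rule AutoGroup)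
  interpret N: normal "?H" "AutoGroup G" by (rule inner_auts_normal)
  define Q where "Q = AutoGroup G Mod ?H"
  have OutG: "OutGroup G = Q" by (simp add: OutGroup_def Q_def)
  interpret Q: group Q unfolding Q_def by (rule N.factorgroup_is_group)
  interpret AQ: group "AutoGroup Q" by (rule Q.AutoGroup)
  interpret NQ: normal "inner_auts Q" "AutoGroup Q" by (rule Q.inner_auts_normal)
  define \<psi> where "\<psi> k = (\<lambda>C\<in>carrier Q. \<Phi> k ` C)" for k
  have \<Phi>H: "\<Phi> k ` ?H = ?H" if "k \<in> K" for k
    by (simp add: inner[OF that])
  have \<psi>: "\<psi> k \<in> auto Q" if "k \<in> K" for k
    unfolding \<psi>_def Q_def 
    by (rule N.auto_FactGroup[OF hom[OF that] _ \<Phi>H[OF that]]) (simp add: bij[OF that])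
  have carQ: "carrier Q = (\<lambda>f. ?H #>\<^bsub>AutoGroup G\<^esub> f) ` auto G"
    by (simp add: Q_def carrier_FactGroup)
  have \<psi>_coset: "\<psi> k (?H #>\<^bsub>AutoGroup G\<^esub> f) = ?H #>\<^bsub>AutoGroup G\<^esub> \<Phi> k f"
    if "k \<in> K" "f \<in> auto G" for k f
    using that by (simp add: \<psi>_def carQ N.image_coset[OF hom[OF that(1)] \<Phi>H[OF that(1)]])
  have "inj_on (\<lambda>k. inner_auts Q #>\<^bsub>AutoGroup Q\<^esub> \<psi> k) K"
  proof (rule inj_onI)
    fix k l assume k: "k \<in> K" and l: "l \<in> K"
      and eq: "inner_auts Q #>\<^bsub>AutoGroup Q\<^esub> \<psi> k = inner_auts Q #>\<^bsub>AutoGroup Q\<^esub> \<psi> l"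
    have "\<psi> k \<in> inner_auts Q #>\<^bsub>AutoGroup Q\<^esub> \<psi> l"
      using AQ.rcos_self[of "\<psi> k" "inner_auts Q"] NQ.subgroup_axioms \<psi>[OF k] eq by simp
    then obtain q where q: "q \<in> carrier Q"
      and "\<psi> k = Q.conj_by q \<otimes>\<^bsub>AutoGroup Q\<^esub> \<psi> l"
      by (auto simp: r_coset_def Q.inner_auts_eq)
    hence \<psi>kl: "\<psi> k = compose (carrier Q) (Q.conj_by q) (\<psi> l)"
      using \<psi>[OF l] Q.conj_by_auto[OF q] by simp
    obtain g where g: "g \<in> auto G" and qg: "q = ?H #>\<^bsub>AutoGroup G\<^esub> g"
      using q by (auto simp: carQ)
    show "k = l"
    proof (rule sep[OF k l g])
      fix f assume f: "f \<in> auto G"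
      let ?C = "?H #>\<^bsub>AutoGroup G\<^esub> f"
      have C: "?C \<in> carrier Q" using f by (simp add: carQ)
      have \<Phi>f: "\<Phi> k f \<in> auto G" "\<Phi> l f \<in> auto G"
        using bij[OF k] bij[OF l] f by (auto simp: bij_betw_def)
      have "\<psi> k ?C = q \<otimes>\<^bsub>Q\<^esub> \<psi> l ?C \<otimes>\<^bsub>Q\<^esub> inv\<^bsub>Q\<^esub> q"
        using C auto_closed[OF \<psi>[OF l] C] by (simp add: \<psi>kl compose_def Q.conj_by_def)
      \<comment> \<open>Moving \<open>q\<close> across removes the inverse, so both sides are cosets
        of products and can be compared through representatives.\<close>
      hence "\<psi> k ?C \<otimes>\<^bsub>Q\<^esub> q = q \<otimes>\<^bsub>Q\<^esub> \<psi> l ?C"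
        using q auto_closed[OF \<psi>[OF l] C] by (simp add: Q.m_assoc)
      hence "?H #>\<^bsub>AutoGroup G\<^esub> (\<Phi> k f \<otimes>\<^bsub>AutoGroup G\<^esub> g)
          = ?H #>\<^bsub>AutoGroup G\<^esub> (g \<otimes>\<^bsub>AutoGroup G\<^esub> \<Phi> l f)"
        using \<psi>_coset[OF k f] \<psi>_coset[OF l f] g \<Phi>f
        by (simp add: qg Q_def N.rcos_sum del: mult_AutoGroup)
      moreover have "\<Phi> k f \<otimes>\<^bsub>AutoGroup G\<^esub> g \<in> ?H #>\<^bsub>AutoGroup G\<^esub> (\<Phi> k f \<otimes>\<^bsub>AutoGroup G\<^esub> g)"
        by (rule A.rcos_self) (use g \<Phi>f N.subgroup_axioms A.m_closed in \<open>simp_all del: mult_AutoGroup\<close>)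
      ultimately obtain h where h: "h \<in> ?H"
        "\<Phi> k f \<otimes>\<^bsub>AutoGroup G\<^esub> g = h \<otimes>\<^bsub>AutoGroup G\<^esub> (g \<otimes>\<^bsub>AutoGroup G\<^esub> \<Phi> l f)"
        by (auto simp: r_coset_def)
      then obtain w where w: "w \<in> carrier G" "h = conj_by w" by (auto simp: inner_auts_eq)
      have eq': "compose (carrier G) (\<Phi> k f) g
          = compose (carrier G) (conj_by w) (compose (carrier G) g (\<Phi> l f))"
        using h(2) g \<Phi>f w A.m_closed[of g "\<Phi> l f"] by (simp add: conj_by_auto)
      have "\<Phi> k f (g x) = w \<otimes> g (\<Phi> l f x) \<otimes> inv w" if "x \<in> carrier G" for x
        using that fun_cong[OF eq', of x] auto_closed[OF g auto_closed[OF \<Phi>f(2) that]]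
        by (simp add: compose_def conj_by_def)
      thus "\<exists>w\<in>carrier G. \<forall>x\<in>carrier G. \<Phi> k f (g x) = w \<otimes> g (\<Phi> l f x) \<otimes> inv w"
        using w by auto
    qed
  qed
  moreover have "(\<lambda>k. inner_auts Q #>\<^bsub>AutoGroup Q\<^esub> \<psi> k) ` K \<subseteq> carrier (OutGroup (OutGroup G))"
    using \<psi> by (auto simp: OutGroup_def[of Q] OutG carrier_FactGroup)
  \<comment> \<open>An infinite carrier has \<open>card\<close> 0, hence the disjunction.\<close>
  ultimately show ?thesis
    using card_inj_on_le by blast
qed

section \<open>Right-angled Artin groups\<close>

fun letter_inv :: "'v \<times> bool \<Rightarrow> 'v \<times> bool"
  where "letter_inv (v, b) = (v, \<not> b)"

lemma letter_inv_letter_inv [simp]: "letter_inv (letter_inv l) = l"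
  by (cases l) simp

lemma fst_letter_inv [simp]: "fst (letter_inv l) = fst l"
  by (cases l) simp

lemma commute_inv:
  assumes "group K" "a \<in> carrier K" "b \<in> carrier K" "a \<otimes>\<^bsub>K\<^esub> b = b \<otimes>\<^bsub>K\<^esub> a"
  shows "inv\<^bsub>K\<^esub> a \<otimes>\<^bsub>K\<^esub> b = b \<otimes>\<^bsub>K\<^esub> inv\<^bsub>K\<^esub> a"
proof -
  interpret group K by fact
  have "inv\<^bsub>K\<^esub> a \<otimes>\<^bsub>K\<^esub> b = inv\<^bsub>K\<^esub> a \<otimes>\<^bsub>K\<^esub> (b \<otimes>\<^bsub>K\<^esub> a) \<otimes>\<^bsub>K\<^esub> inv\<^bsub>K\<^esub> a"
    using assms(2,3) by (simp add: m_assoc)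
  also have "\<dots> = b \<otimes>\<^bsub>K\<^esub> inv\<^bsub>K\<^esub> a"
    using assms(2,3) by (simp flip: assms(4) add: m_assoc)
  finally show ?thesis .
qed

section \<open>Words modulo the relations form a group\<close>

locale raag =
  fixes V :: "'v set" and E :: "'v \<Rightarrow> 'v \<Rightarrow> bool"
begin

abbreviation A :: "'v raag_word set monoid" where "A \<equiv> RAAG V E"
abbreviation weq (infix "\<approx>" 50) where "u \<approx> w \<equiv> raag_eq V E u w"
abbreviation "words \<equiv> raag_words V"
abbreviation "cls \<equiv> raag_class V E"

definition x :: "'v \<Rightarrow> 'v raag_word set"
  where "x v = cls [(v, True)]"

lemma Nil_words [simp]: "[] \<in> words"
  by (simp add: raag_words_def)

lemma Cons_words [simp]: "l # w \<in> words \<longleftrightarrow> fst l \<in> V \<and> w \<in> words"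
  by (cases l) (auto simp: raag_words_def)

lemma append_words [simp]: "u @ w \<in> words \<longleftrightarrow> u \<in> words \<and> w \<in> words"
  by (auto simp: raag_words_def)

lemma weq_words: "u \<approx> w \<Longrightarrow> u \<in> words \<and> w \<in> words"
  by (induction rule: raag_eq.induct) auto

lemma weq_append_left: "u \<approx> w \<Longrightarrow> z \<in> words \<Longrightarrow> z @ u \<approx> z @ w"
proof (induction rule: raag_eq.induct)
  case (cancel xs ys v b)
  thus ?case using raag_eq.cancel[of "z @ xs" V ys v E b] by simp
next
  case (commute xs ys v w b c)
  thus ?case using raag_eq.commute[of "z @ xs" V ys v w E b c] by simp
qed (auto intro: raag_eq.intros)

lemma weq_append_right: "u \<approx> w \<Longrightarrow> z \<in> words \<Longrightarrow> u @ z \<approx> w @ z"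
proof (induction rule: raag_eq.induct)
  case (cancel xs ys v b)
  thus ?case using raag_eq.cancel[of xs V "ys @ z" v E b] by simp
next
  case (commute xs ys v w b c)
  thus ?case using raag_eq.commute[of xs V "ys @ z" v w E b c] by simp
qed (auto intro: raag_eq.intros)

lemma weq_append: "u \<approx> u' \<Longrightarrow> w \<approx> w' \<Longrightarrow> u @ w \<approx> u' @ w'"
  by (meson raag_eq.trans weq_append_left weq_append_right weq_words)

lemma cls_eq_iff: "u \<in> words \<Longrightarrow> cls u = cls w \<longleftrightarrow> u \<approx> w"
  unfolding raag_class_def by (blast intro: raag_eq.intros)

lemma cls_closed [simp]: "w \<in> words \<Longrightarrow> cls w \<in> carrier A"
  by (simp add: RAAG_def)

lemma carrierE:
  assumes "a \<in> carrier A"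
  obtains w where "w \<in> words" "a = cls w"
  using assms by (auto simp: RAAG_def)

lemma cls_mult:
  assumes "u \<in> words" "w \<in> words"
  shows "cls u \<otimes>\<^bsub>A\<^esub> cls w = cls (u @ w)"
proof -
  have "(\<exists>a b. u \<approx> a \<and> w \<approx> b \<and> a @ b \<approx> c) \<longleftrightarrow> u @ w \<approx> c" for c
  proof
    assume "\<exists>a b. u \<approx> a \<and> w \<approx> b \<and> a @ b \<approx> c"
    thus "u @ w \<approx> c" using weq_append raag_eq.trans by metis
  next
    assume "u @ w \<approx> c"
    thus "\<exists>a b. u \<approx> a \<and> w \<approx> b \<and> a @ b \<approx> c" using assms by (meson raag_eq.refl)
  qed
  thus ?thesis by (auto simp: RAAG_def raag_class_def)
qed

lemma one_eq: "\<one>\<^bsub>A\<^esub> = cls []"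
  by (simp add: RAAG_def)

lemma letter_cancel: "fst l \<in> V \<Longrightarrow> [l, letter_inv l] \<approx> []"
  using raag_eq.cancel[of "[]" V "[]" "fst l" E "snd l"] by (cases l) simp

lemma word_inverse: "w \<in> words \<Longrightarrow> \<exists>w'\<in>words. w' @ w \<approx> []"
proof (induction w)
  case Nil
  show ?case by (rule bexI[of _ "[]"]) (auto intro: raag_eq.refl)
next
  case (Cons l w)
  then obtain w' where w': "w' \<in> words" "w' @ w \<approx> []" by auto
  have "w' @ [letter_inv l, l] @ w \<approx> w' @ [] @ w"
    using letter_cancel[of "letter_inv l"] Cons.prems w'(1)
    by (intro weq_append) (auto intro: raag_eq.refl)
  hence "(w' @ [letter_inv l]) @ l # w \<approx> []"
    using w'(2) by (auto intro: raag_eq.trans)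
  thus ?case using w'(1) Cons.prems by (intro bexI[of _ "w' @ [letter_inv l]"]) auto
qed

lemma group_A: "group A"
proof (rule groupI)
  fix a assume "a \<in> carrier A"
  then obtain w where w: "w \<in> words" "a = cls w" by (rule carrierE)
  obtain w' where "w' \<in> words" "w' @ w \<approx> []" using word_inverse[OF w(1)] by auto
  thus "\<exists>b\<in>carrier A. b \<otimes>\<^bsub>A\<^esub> a = \<one>\<^bsub>A\<^esub>"
    using w by (intro bexI[of _ "cls w'"]) (auto simp: cls_mult one_eq cls_eq_iff)
qed (auto elim!: carrierE simp: cls_mult one_eq)

sublocale A: group A
  by (rule group_A)

lemma x_closed [simp]: "v \<in> V \<Longrightarrow> x v \<in> carrier A"
  by (simp add: x_def)

lemma cls_letter: "v \<in> V \<Longrightarrow> cls [(v, b)] = (if b then x v else inv\<^bsub>A\<^esub> x v)"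
  using letter_cancel[of "(v, False)"] A.inv_equality[of "cls [(v, False)]" "x v"]
  by (auto simp: x_def cls_mult one_eq cls_eq_iff)

lemma cls_Cons: "l # w \<in> words \<Longrightarrow> cls (l # w) = cls [l] \<otimes>\<^bsub>A\<^esub> cls w"
  by (simp add: cls_mult)

lemma carrier_induct [consumes 1, case_names one mult inv_mult]:
  assumes "a \<in> carrier A" "P \<one>\<^bsub>A\<^esub>"
    and "\<And>v a. v \<in> V \<Longrightarrow> a \<in> carrier A \<Longrightarrow> P a \<Longrightarrow> P (x v \<otimes>\<^bsub>A\<^esub> a)"
    and "\<And>v a. v \<in> V \<Longrightarrow> a \<in> carrier A \<Longrightarrow> P a \<Longrightarrow> P (inv\<^bsub>A\<^esub> x v \<otimes>\<^bsub>A\<^esub> a)"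
  shows "P a"
proof -
  have "P (cls w)" if "w \<in> words" for w
    using that
  proof (induction w)
    case Nil
    show ?case using assms(2) by (simp add: one_eq)
  next
    case (Cons l w)
    obtain v b where "l = (v, b)" by (cases l)
    thus ?case
      using Cons assms(3,4)[of v "cls w"] cls_Cons[OF Cons.prems] by (auto simp: cls_letter)
  qed
  thus ?thesis using assms(1) by (auto elim: carrierE)
qed

lemma x_commute: "E v w \<Longrightarrow> v \<in> V \<Longrightarrow> w \<in> V \<Longrightarrow> x v \<otimes>\<^bsub>A\<^esub> x w = x w \<otimes>\<^bsub>A\<^esub> x v"
  using raag_eq.commute[of "[]" V "[]" v w E True True] by (simp add: x_def cls_mult cls_eq_iff)

section \<open>The universal property of the presentation\<close>

lemma hom_unique:
  assumes "group K" "\<phi> \<in> hom A K" "\<psi> \<in> hom A K" "\<And>v. v \<in> V \<Longrightarrow> \<phi> (x v) = \<psi> (x v)"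
    and "a \<in> carrier A"
  shows "\<phi> a = \<psi> a"
proof -
  interpret f: group_hom A K \<phi>
    using assms by (simp add: group_hom_def group_hom_axioms_def A.is_group)
  interpret g: group_hom A K \<psi>
    using assms by (simp add: group_hom_def group_hom_axioms_def A.is_group)
  from assms(5) show ?thesis
    by (induction rule: carrier_induct) (auto simp: assms(4))
qed

text \<open>Von Dyck's theorem for this presentation: a word is evaluated letter by letter in
  \<open>K\<close>, and each rule of \<open>raag_eq\<close> preserves the value.\<close>

lemma hom_extension:
  assumes "group K" and f: "\<And>v. v \<in> V \<Longrightarrow> f v \<in> carrier K"
    and comm: "\<And>v w. v \<in> V \<Longrightarrow> w \<in> V \<Longrightarrow> E v w \<Longrightarrow> f v \<otimes>\<^bsub>K\<^esub> f w = f w \<otimes>\<^bsub>K\<^esub> f v"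
  obtains \<phi> where "\<phi> \<in> hom A K" "\<And>v. v \<in> V \<Longrightarrow> \<phi> (x v) = f v"
proof -
  interpret K: group K by fact
  define g where "g l = (if snd l then f (fst l) else inv\<^bsub>K\<^esub> f (fst l))" for l
  define ev where "ev w = foldr (\<lambda>l a. g l \<otimes>\<^bsub>K\<^esub> a) w \<one>\<^bsub>K\<^esub>" for w
  have g: "g l \<in> carrier K" if "fst l \<in> V" for l
    using f that by (auto simp: g_def)
  have ev_closed: "ev w \<in> carrier K" if "w \<in> words" for w
    using that by (induction w) (auto simp: ev_def g)
  have ev_append: "ev (u @ w) = ev u \<otimes>\<^bsub>K\<^esub> ev w" if "u \<in> words" "w \<in> words" for u w
    using that(1)
  proof (induction u)
    case Nil
    show ?case using ev_closed[OF that(2)] by (simp add: ev_def)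
  next
    case (Cons l u)
    thus ?case
      using ev_closed[of u] ev_closed[OF that(2)] g[of l] by (simp add: ev_def K.m_assoc)
  qed
  have g_comm: "g (v, b) \<otimes>\<^bsub>K\<^esub> g (w, c) = g (w, c) \<otimes>\<^bsub>K\<^esub> g (v, b)"
    if "v \<in> V" "w \<in> V" "E v w" for v w b c
  proof -
    have 1: "g (v, b) \<otimes>\<^bsub>K\<^esub> f w = f w \<otimes>\<^bsub>K\<^esub> g (v, b)"
      using comm[OF that] commute_inv[OF K.is_group f f, of v w] that by (simp add: g_def)
    show ?thesis
      using 1 commute_inv[OF K.is_group f g, of w "(v, b)"] that by (simp add: g_def split: if_splits)
  qed
  have ev_weq: "u \<approx> w \<Longrightarrow> ev u = ev w" for u w
  proof (induction rule: raag_eq.induct)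
    case (cancel xs ys v b)
    have "ev [(v, b), (v, \<not> b)] = \<one>\<^bsub>K\<^esub>"
      using cancel by (simp add: ev_def g_def f)
    thus ?case
      using cancel ev_append[of xs "[(v, b), (v, \<not> b)] @ ys"] ev_append[of "[(v, b), (v, \<not> b)]" ys]
      by (simp add: ev_closed ev_append)
  next
    case (commute xs ys v w b c)
    have "ev [(v, b), (w, c)] = ev [(w, c), (v, b)]"
      using commute g_comm[of v w b c] by (simp add: ev_def g)
    thus ?case
      using commute ev_append[of xs "[(v, b), (w, c)] @ ys"] ev_append[of "[(v, b), (w, c)]" ys]
        ev_append[of xs "[(w, c), (v, b)] @ ys"] ev_append[of "[(w, c), (v, b)]" ys]
      by simp
  qed auto
  define \<phi> where "\<phi> C = ev (SOME w. w \<in> C)" for C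
  have \<phi>: "\<phi> (cls w) = ev w" if "w \<in> words" for w
  proof -
    have "w \<approx> (SOME u. u \<in> cls w)"
      using someI[of "\<lambda>u. u \<in> cls w" w] raag_eq.refl[OF that] by (simp add: raag_class_def)
    thus ?thesis using ev_weq by (simp add: \<phi>_def)
  qed
  show ?thesis
  proof (rule that)
    show "\<phi> \<in> hom A K"
      by (rule homI) (auto elim!: carrierE simp: \<phi> ev_closed ev_append cls_mult)
    show "\<phi> (x v) = f v" if "v \<in> V" for v
      using that f by (simp add: x_def \<phi> ev_def g_def)
  qed
qed

text \<open>The exponent sum of the generator \<open>i\<close>, a coordinate of the abelianization.
  \<open>hom_extension\<close> provides it; \<open>hom_unique\<close> makes it unique on the
  carrier.\<close>

definition ex :: "'v \<Rightarrow> 'v raag_word set \<Rightarrow> int"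
  where "ex i = (SOME \<phi>. \<phi> \<in> hom A integer_group \<and> (\<forall>v\<in>V. \<phi> (x v) = (if v = i then 1 else 0)))"

lemma ex_hom: "ex i \<in> hom A integer_group"
  and ex_x [simp]: "v \<in> V \<Longrightarrow> ex i (x v) = (if v = i then 1 else 0)"
proof -
  obtain \<phi> where "\<phi> \<in> hom A integer_group \<and> (\<forall>v\<in>V. \<phi> (x v) = (if v = i then 1 else 0))"
    by (rule hom_extension[OF group_integer_group, of "\<lambda>v. if v = i then 1 else 0"]) auto
  hence "ex i \<in> hom A integer_group \<and> (\<forall>v\<in>V. ex i (x v) = (if v = i then 1 else 0))"
    unfolding ex_def by (rule someI[where P = "\<lambda>\<phi>. \<phi> \<in> _ \<and> _ \<phi>"])
  thus "ex i \<in> hom A integer_group" "v \<in> V \<Longrightarrow> ex i (x v) = (if v = i then 1 else 0)"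
    by auto
qed

sublocale ex: group_hom A integer_group "ex i" for i
  by (simp add: group_hom_def group_hom_axioms_def A.is_group ex_hom)

lemma ex_mult [simp]:
  "a \<in> carrier A \<Longrightarrow> b \<in> carrier A \<Longrightarrow> ex i (a \<otimes>\<^bsub>A\<^esub> b) = ex i a + ex i b"
  using ex.hom_mult by simp

lemma ex_one [simp]: "ex i \<one>\<^bsub>A\<^esub> = 0"
  using ex.hom_one by simp

lemma ex_inv [simp]: "a \<in> carrier A \<Longrightarrow> ex i (inv\<^bsub>A\<^esub> a) = - ex i a"
  using ex.hom_inv by simp

lemma ex_int_pow [simp]:
  assumes "a \<in> carrier A"
  shows "ex i (a [^]\<^bsub>A\<^esub> (n :: int)) = n * ex i a"
proof (induction n rule: int_induct[of _ 0])
  case (step1 n)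
  thus ?case using assms by (simp add: A.int_pow_mult algebra_simps)
next
  case (step2 n)
  thus ?case using assms by (simp add: A.int_pow_diff algebra_simps)
qed simp

text \<open>An additive map to the integers factors through the abelianization. Later this is
  applied to differences of Magnus coefficients, which are additive although the coefficients are
  not.\<close>

lemma additive_eq_sum:
  fixes f :: "'v raag_word set \<Rightarrow> int"
  assumes "finite V" and add: "\<And>a b. a \<in> carrier A \<Longrightarrow> b \<in> carrier A \<Longrightarrow> f (a \<otimes>\<^bsub>A\<^esub> b) = f a + f b"
    and "a \<in> carrier A"
  shows "f a = (\<Sum>v\<in>V. f (x v) * ex v a)"
proof -
  have "(\<lambda>a. \<Sum>v\<in>V. f (x v) * ex v a) \<in> hom A integer_group"
    by (rule homI) (simp_all add: distrib_left sum.distrib)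
  moreover have "f \<in> hom A integer_group"
    by (rule homI) (simp_all add: add)
  ultimately show ?thesis
    using assms(1,3)
    by (intro hom_unique[OF group_integer_group _ _ _ assms(3), of f])
      (simp_all add: if_distrib sum.delta cong: if_cong)
qed

end

text \<open>The integral Heisenberg group: \<open>(a, b, c)\<close> stands for the upper
  unitriangular matrix with \<open>a\<close>, \<open>b\<close> above the diagonal and
  \<open>c\<close> in the corner.\<close>

definition heisenberg :: "(int \<times> int \<times> int) monoid"
  where "heisenberg = \<lparr>carrier = UNIV,
    monoid.mult = (\<lambda>(a, b, c) (a', b', c'). (a + a', b + b', c + c' + a * b')),
    one = (0, 0, 0)\<rparr>"

lemma group_heisenberg: "group heisenberg"
proof (rule groupI)
  fix p assume "p \<in> carrier heisenberg"
  obtain a b c where p: "p = (a, b, c)" by (cases p)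
  show "\<exists>q\<in>carrier heisenberg. q \<otimes>\<^bsub>heisenberg\<^esub> p = \<one>\<^bsub>heisenberg\<^esub>"
    by (rule bexI[of _ "(- a, - b, a * b - c)"]) (simp_all add: heisenberg_def p)
qed (auto simp: heisenberg_def algebra_simps)

context raag
begin

text \<open>The coefficient of \<open>X\<^sub>i X\<^sub>j\<close> in the Magnus expansion.\<close>

lemma magnus_coefficient:
  assumes "i \<noteq> j" "\<not> E i j" "\<not> E j i"
  obtains m where
    "\<And>a b. a \<in> carrier A \<Longrightarrow> b \<in> carrier A \<Longrightarrow> m (a \<otimes>\<^bsub>A\<^esub> b) = m a + m b + ex i a * ex j b"
    "\<And>v. v \<in> V \<Longrightarrow> m (x v) = (0::int)"
proof -
  \<comment> \<open>\<open>i\<close> and \<open>j\<close> go to the two standard generators of the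
    Heisenberg group, all other vertices to the identity. Only the images of \<open>i\<close> and
    \<open>j\<close> fail to commute, and these vertices are not adjacent. The corner entry is the
    desired coefficient.\<close>
  let ?f = "\<lambda>v. (if v = i then 1 else 0, if v = j then 1 else 0, 0) :: int \<times> int \<times> int"
  obtain \<phi> where \<phi>: "\<phi> \<in> hom A heisenberg" "\<And>v. v \<in> V \<Longrightarrow> \<phi> (x v) = ?f v"
    by (rule hom_extension[OF group_heisenberg, of ?f])
      (use assms in \<open>auto simp: heisenberg_def\<close>)
  have mult: "\<phi> (a \<otimes>\<^bsub>A\<^esub> b) = (fst (\<phi> a) + fst (\<phi> b), fst (snd (\<phi> a)) + fst (snd (\<phi> b)),
      snd (snd (\<phi> a)) + snd (snd (\<phi> b)) + fst (\<phi> a) * fst (snd (\<phi> b)))"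
    if "a \<in> carrier A" "b \<in> carrier A" for a b
    using hom_mult[OF \<phi>(1) that] by (simp add: heisenberg_def split: prod.splits)
  have "(\<lambda>a. fst (\<phi> a)) \<in> hom A integer_group" "(\<lambda>a. fst (snd (\<phi> a))) \<in> hom A integer_group"
    by (auto intro!: homI simp: mult)
  hence "fst (\<phi> a) = ex i a" "fst (snd (\<phi> a)) = ex j a" if "a \<in> carrier A" for a
    using hom_unique[OF group_integer_group _ ex_hom _ that] by (auto simp: \<phi>(2))
  thus ?thesis
    using that[of "\<lambda>a. snd (snd (\<phi> a))"] by (simp add: mult \<phi>(2))
qed

end

section \<open>Cones over complete multipartite graphs\<close>

text \<open>The graph is the complete multipartite graph whose parts are the fibres of \<open>blk\<close>; the part of
  \<open>t\<close> is a singleton, so \<open>t\<close> is adjacent to every other vertex, and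
  \<open>A \<cong> \<int> \<times> \<Prod> F\<^sub>n\<close> with one free factor for each of the other parts.\<close>

locale cone_multipartite =
  fixes V :: "'v set" and blk :: "'v \<Rightarrow> 'k" and t :: 'v
  assumes fin: "finite V" and t_in [simp]: "t \<in> V"
    and blk_t: "v \<in> V \<Longrightarrow> blk v = blk t \<Longrightarrow> v = t"
    and card_block: "v \<in> V \<Longrightarrow> v \<noteq> t \<Longrightarrow> 3 \<le> card {u \<in> V. blk u = blk v}"
    and card_inj: "v \<in> V \<Longrightarrow> w \<in> V \<Longrightarrow>
      card {u \<in> V. blk u = blk v} = card {u \<in> V. blk u = blk w} \<Longrightarrow> blk v = blk w"
begin

definition E :: "'v \<Rightarrow> 'v \<Rightarrow> bool"
  where "E v w \<longleftrightarrow> v \<in> V \<and> w \<in> V \<and> blk v \<noteq> blk w"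

sublocale raag V E .

lemma simplicial: "simplicial_graph V E"
  using fin by (auto simp: simplicial_graph_def E_def)

subsection \<open>The centre\<close>

text \<open>The normal forms of the free group on the block \<open>b\<close>.\<close>

definition reduced :: "'k \<Rightarrow> 'v raag_word set"
  where "reduced b = {w \<in> words. (\<forall>l\<in>set w. blk (fst l) = b) \<and>
    successively (\<lambda>l m. m \<noteq> letter_inv l) w}"

text \<open>Left multiplication by a letter on these normal forms; at most one cancellation
  occurs.\<close>

definition act :: "'v \<times> bool \<Rightarrow> 'v raag_word \<Rightarrow> 'v raag_word"
  where "act l s = (case s of [] \<Rightarrow> [l] | m # s' \<Rightarrow> if m = letter_inv l then s' else l # s)"

lemma reduced_words: "w \<in> reduced b \<Longrightarrow> w \<in> words"
  by (simp add: reduced_def)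

lemma Nil_reduced [simp]: "[] \<in> reduced b"
  by (simp add: reduced_def)

lemma Cons_reduced:
  "l # w \<in> reduced b \<longleftrightarrow> fst l \<in> V \<and> blk (fst l) = b \<and> w \<in> reduced b \<and>
     (w \<noteq> [] \<longrightarrow> hd w \<noteq> letter_inv l)"
  by (auto simp: reduced_def successively_Cons)

lemma act_reduced: "s \<in> reduced b \<Longrightarrow> fst l \<in> V \<Longrightarrow> blk (fst l) = b \<Longrightarrow> act l s \<in> reduced b"
  by (auto simp: act_def Cons_reduced split: list.splits)

lemma act_inverse: "s \<in> reduced b \<Longrightarrow> act l (act (letter_inv l) s) = s"
  by (auto simp: act_def Cons_reduced split: list.splits)

lemma act_Cons: "l # s \<in> reduced b \<Longrightarrow> act l s = l # s"
  by (auto simp: act_def Cons_reduced split: list.splits)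

lemma cls_act: "s \<in> reduced b \<Longrightarrow> fst l \<in> V \<Longrightarrow> cls (act l s) = cls (l # s)"
proof -
  assume s: "s \<in> reduced b" and l: "fst l \<in> V"
  show ?thesis
  proof (cases "\<exists>s'. s = letter_inv l # s'")
    case True
    then obtain s' where s': "s = letter_inv l # s'" by auto
    hence "s' \<in> words" using reduced_words[OF s] by simp
    hence "weq ([l, letter_inv l] @ s') ([] @ s')"
      using letter_cancel[OF l] by (intro weq_append) (auto intro: raag_eq.refl)
    thus ?thesis
      using s' l \<open>s' \<in> words\<close> cls_eq_iff[of "l # s" s'] by (simp add: act_def)
  qed (auto simp: act_def split: list.splits)
qed

text \<open>Van der Waerden's device for the projection of \<open>A\<close> onto the free factor of
  \<open>b\<close>: acting on the empty word reads off the normal form of an element.\<close>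

lemma reduced_action:
  obtains \<rho> where
    "\<And>s. s \<in> reduced b \<Longrightarrow> \<rho> \<one>\<^bsub>A\<^esub> s = s"
    "\<And>a a' s. a \<in> carrier A \<Longrightarrow> a' \<in> carrier A \<Longrightarrow> s \<in> reduced b \<Longrightarrow> \<rho> (a \<otimes>\<^bsub>A\<^esub> a') s = \<rho> a (\<rho> a' s)"
    "\<And>l s. fst l \<in> V \<Longrightarrow> s \<in> reduced b \<Longrightarrow> \<rho> (cls [l]) s = (if blk (fst l) = b then act l s else s)"
proof -
  let ?S = "reduced b"
  define f where "f l = (\<lambda>s\<in>?S. if blk (fst l) = b then act l s else s)" for l :: "'v \<times> bool"
  have f_closed: "f l s \<in> ?S" if "fst l \<in> V" "s \<in> ?S" for l s
    using that by (simp add: f_def act_reduced)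
  have f_inverse: "f l (f (letter_inv l) s) = s" if "fst l \<in> V" "s \<in> ?S" for l s
    using that act_reduced[of s b "letter_inv l"] by (simp add: f_def act_inverse)
  have f_Bij: "f l \<in> Bij ?S" if "fst l \<in> V" for l
  proof -
    have "bij_betw (f l) ?S ?S"
      using that f_closed[of "letter_inv l"] f_inverse[of l] f_inverse[of "letter_inv l"]
      by (intro bij_betw_byWitness[where f' = "f (letter_inv l)"]) (auto simp: f_closed)
    thus ?thesis by (auto simp: Bij_def f_def)
  qed
  interpret B: group "BijGroup ?S" by (rule group_BijGroup)
  have car: "carrier (BijGroup ?S) = Bij ?S" by (simp add: BijGroup_def)
  have mult: "p \<otimes>\<^bsub>BijGroup ?S\<^esub> q = compose ?S p q" if "p \<in> Bij ?S" "q \<in> Bij ?S" for p q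
    using that by (simp add: BijGroup_def)
  have one: "\<one>\<^bsub>BijGroup ?S\<^esub> = (\<lambda>s\<in>?S. s)" by (simp add: BijGroup_def)
  obtain \<rho> where \<rho>: "\<rho> \<in> hom A (BijGroup ?S)" "\<And>v. v \<in> V \<Longrightarrow> \<rho> (x v) = f (v, True)"
  proof (rule hom_extension[OF group_BijGroup, of "\<lambda>v. f (v, True)" ?S])
    fix v w assume vw: "v \<in> V" "w \<in> V" "E v w"
    \<comment> \<open>Adjacent vertices lie in different blocks, so at least one of the two maps is
      the identity.\<close>
    have "compose ?S (f (v, True)) (f (w, True)) = compose ?S (f (w, True)) (f (v, True))"
      using vw f_closed[of "(v, True)"] f_closed[of "(w, True)"]
      by (auto simp: compose_def fun_eq_iff f_def E_def)
    thus "f (v, True) \<otimes>\<^bsub>BijGroup ?S\<^esub> f (w, True) = f (w, True) \<otimes>\<^bsub>BijGroup ?S\<^esub> f (v, True)"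
      using vw by (simp add: mult f_Bij)
  qed (auto simp: car f_Bij)
  interpret \<rho>: group_hom A "BijGroup ?S" \<rho>
    by (simp add: group_hom_def group_hom_axioms_def A.is_group B.is_group \<rho>(1))
  have \<rho>_Bij: "\<rho> a \<in> Bij ?S" if "a \<in> carrier A" for a
    using \<rho>.hom_closed[OF that] by (simp add: car)
  have \<rho>_letter: "\<rho> (cls [l]) = f l" if l: "fst l \<in> V" for l
  proof (cases "snd l")
    case True
    thus ?thesis using l \<rho>(2)[of "fst l"] by (cases l) (simp add: x_def)
  next
    case False
    then obtain v where lv: "l = (v, False)" by (cases l) auto
    have "compose ?S (f (v, False)) (f (v, True)) = (\<lambda>s\<in>?S. s)"
      using l lv f_inverse[of "(v, False)"] by (auto simp: compose_def)
    hence "inv\<^bsub>BijGroup ?S\<^esub> f (v, True) = f (v, False)"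
      using l lv by (intro B.inv_equality) (simp_all add: car mult one f_Bij)
    thus ?thesis using l lv by (simp add: cls_letter \<rho>(2))
  qed
  show ?thesis
  proof (rule that[of \<rho>])
    show "\<rho> \<one>\<^bsub>A\<^esub> s = s" if "s \<in> ?S" for s
      using that by (simp add: one)
    show "\<rho> (a \<otimes>\<^bsub>A\<^esub> a') s = \<rho> a (\<rho> a' s)"
      if "a \<in> carrier A" "a' \<in> carrier A" "s \<in> ?S" for a a' s
      using that by (simp add: mult \<rho>_Bij compose_eq)
    show "\<rho> (cls [l]) s = (if blk (fst l) = b then act l s else s)" if "fst l \<in> V" "s \<in> ?S" for l s
      using that by (simp add: \<rho>_letter f_def)
  qed
qed

lemma letter_commute:
  assumes "fst l \<in> V" "w \<in> words" "\<And>m. m \<in> set w \<Longrightarrow> blk (fst m) \<noteq> blk (fst l)"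
  shows "cls [l] \<otimes>\<^bsub>A\<^esub> cls w = cls w \<otimes>\<^bsub>A\<^esub> cls [l]"
  using assms(2,3)
proof (induction w)
  case Nil
  thus ?case using assms(1) by (simp flip: one_eq)
next
  case (Cons m w)
  have "cls [l] \<otimes>\<^bsub>A\<^esub> cls [m] = cls [m] \<otimes>\<^bsub>A\<^esub> cls [l]"
    using Cons.prems(1) Cons.prems(2)[of m] assms(1)
      raag_eq.commute[of "[]" V "[]" "fst l" "fst m" E "snd l" "snd m"]
    by (auto simp: cls_mult cls_eq_iff E_def)
  moreover have "cls [l] \<otimes>\<^bsub>A\<^esub> cls w = cls w \<otimes>\<^bsub>A\<^esub> cls [l]"
    using Cons by simp
  ultimately show ?case
    using Cons.prems assms(1) cls_Cons[of m w]
    by (metis (no_types, lifting) A.m_assoc cls_closed Cons_words Nil_words)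
qed

text \<open>Letters outside the block commute with those inside, so the latter can be collected in
  front and reduced there. The letters of \<open>r\<close> are recorded so that blocks can be
  eliminated one after another.\<close>

lemma block_normal_form:
  assumes "u \<in> words"
  obtains w r where "w \<in> reduced b" "r \<in> words" "set r = {l \<in> set u. blk (fst l) \<noteq> b}"
    "cls u = cls w \<otimes>\<^bsub>A\<^esub> cls r"
proof -
  have "\<exists>w r. w \<in> reduced b \<and> r \<in> words \<and> set r = {l \<in> set u. blk (fst l) \<noteq> b} \<and>
      cls u = cls w \<otimes>\<^bsub>A\<^esub> cls r"
    using assms
  proof (induction u)
    case Nil
    show ?case by (rule exI[of _ "[]"], rule exI[of _ "[]"]) (simp add: cls_mult)
  next
    case (Cons l u)
    then obtain w r where wr: "w \<in> reduced b" "r \<in> words"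
      "set r = {l \<in> set u. blk (fst l) \<noteq> b}" "cls u = cls w \<otimes>\<^bsub>A\<^esub> cls r" by auto
    have l: "fst l \<in> V" and w: "w \<in> words" using Cons.prems wr reduced_words by auto
    have lu: "cls (l # u) = (cls [l] \<otimes>\<^bsub>A\<^esub> cls w) \<otimes>\<^bsub>A\<^esub> cls r"
      using cls_Cons[OF Cons.prems] wr l w by (simp add: A.m_assoc)
    show ?case
    proof (cases "blk (fst l) = b")
      case True
      have "cls (l # u) = cls (act l w) \<otimes>\<^bsub>A\<^esub> cls r"
        using lu cls_act[OF wr(1) l] cls_Cons[of l w] l w by simp
      thus ?thesis
        using wr l True act_reduced[OF wr(1) l True]
        by (intro exI[of _ "act l w"] exI[of _ r]) auto
    next
      case False
      have "cls [l] \<otimes>\<^bsub>A\<^esub> cls w = cls w \<otimes>\<^bsub>A\<^esub> cls [l]"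
        using wr(1) False l w by (intro letter_commute) (auto simp: reduced_def)
      hence "cls (l # u) = cls w \<otimes>\<^bsub>A\<^esub> cls (l # r)"
        using lu wr(2) l w cls_Cons[of l r] by (simp add: A.m_assoc)
      thus ?thesis
        using wr l False by (intro exI[of _ w] exI[of _ "l # r"]) auto
    qed
  qed
  thus ?thesis using that by blast
qed

definition central :: "'v raag_word set \<Rightarrow> bool"
  where "central z \<longleftrightarrow> z \<in> carrier A \<and> (\<forall>a\<in>carrier A. z \<otimes>\<^bsub>A\<^esub> a = a \<otimes>\<^bsub>A\<^esub> z)"

lemma card_ge_3_avoid: "3 \<le> card B \<Longrightarrow> \<exists>v\<in>B. v \<noteq> p \<and> v \<noteq> q"
proof (rule ccontr)
  assume "3 \<le> card B" "\<not> (\<exists>v\<in>B. v \<noteq> p \<and> v \<noteq> q)"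
  hence "card B \<le> card {p, q}" by (intro card_mono) auto
  also have "\<dots> \<le> 2" by (simp add: card_insert_if)
  finally show False using \<open>3 \<le> card B\<close> by simp
qed

text \<open>Let \<open>w\<close> be the part of \<open>z\<close> in the block of \<open>v0\<close>.
  If \<open>w\<close> is nonempty, the three vertices of the block leave some \<open>v\<close> that
  occurs neither in the first nor in the last letter of \<open>w\<close>. Then \<open>v w\<close>
  and \<open>w v\<close> are both reduced and centrality equates them, yet they begin with different
  letters.\<close>

lemma central_avoids_block:
  assumes z: "central z" and u: "u \<in> words" "z = cls u" and v0: "v0 \<in> V" "v0 \<noteq> t"
  obtains r where "r \<in> words" "z = cls r" "set r = {l \<in> set u. blk (fst l) \<noteq> blk v0}"
proof -
  let ?b = "blk v0"
  have zc: "z \<in> carrier A" using z by (simp add: central_def)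
  obtain \<rho> where \<rho>:
    "\<And>s. s \<in> reduced ?b \<Longrightarrow> \<rho> \<one>\<^bsub>A\<^esub> s = s"
    "\<And>a a' s. a \<in> carrier A \<Longrightarrow> a' \<in> carrier A \<Longrightarrow> s \<in> reduced ?b \<Longrightarrow> \<rho> (a \<otimes>\<^bsub>A\<^esub> a') s = \<rho> a (\<rho> a' s)"
    "\<And>l s. fst l \<in> V \<Longrightarrow> s \<in> reduced ?b \<Longrightarrow> \<rho> (cls [l]) s = (if blk (fst l) = ?b then act l s else s)"
    by (rule reduced_action[of ?b]) (rule that; assumption)
  from u(1) obtain w r where wr: "w \<in> reduced ?b" "r \<in> words"
    "set r = {l \<in> set u. blk (fst l) \<noteq> ?b}" "cls u = cls w \<otimes>\<^bsub>A\<^esub> cls r"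
    by (rule block_normal_form)
  have \<rho>_r: "\<rho> (cls r') s = s"
    if "r' \<in> words" "\<And>l. l \<in> set r' \<Longrightarrow> blk (fst l) \<noteq> ?b" "s \<in> reduced ?b" for r' s
    using that
  proof (induction r')
    case Nil
    thus ?case by (simp add: \<rho>(1) flip: one_eq)
  next
    case (Cons l r')
    thus ?case by (simp add: cls_Cons[of l r'] \<rho>(2,3))
  qed
  have \<rho>_w: "\<rho> (cls w') s = w' @ s" if "w' @ s \<in> reduced ?b" "s \<in> reduced ?b" for w' s
    using that
  proof (induction w')
    case Nil
    thus ?case by (simp add: \<rho>(1) flip: one_eq)
  next
    case (Cons l w')
    have ws: "w' @ s \<in> reduced ?b" "fst l \<in> V" "blk (fst l) = ?b"
      using Cons.prems by (simp_all add: Cons_reduced)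
    thus ?case
      using Cons act_Cons[of l "w' @ s"] reduced_words[OF ws(1)]
      by (simp add: cls_Cons[of l w'] \<rho>(2,3))
  qed
  have w: "w \<in> words" using wr reduced_words by auto
  have \<rho>z: "\<rho> z s = w @ s" if "w @ s \<in> reduced ?b" "s \<in> reduced ?b" for s
    using that wr w u \<rho>_r[of r s] \<rho>_w[of w s] by (simp add: \<rho>(2))
  have "w = []"
  proof (rule ccontr)
    assume "w \<noteq> []"
    obtain v where v: "v \<in> V" "blk v = ?b" "v \<noteq> fst (hd w)" "v \<noteq> fst (last w)"
      using card_ge_3_avoid[OF card_block[OF v0]] by blast
    let ?l = "(v, True)"
    have l: "[?l] \<in> reduced ?b" using v by (simp add: Cons_reduced)
    have lw: "?l # w \<in> reduced ?b"
      using v wr(1) by (auto simp: Cons_reduced)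
    have "?l \<noteq> letter_inv (last w)" using v(4) by (metis fst_conv fst_letter_inv)
    hence wl: "w @ [?l] \<in> reduced ?b"
      using v wr(1) l
      by (auto simp: reduced_def successively_append_iff)
    have "\<rho> (cls [?l] \<otimes>\<^bsub>A\<^esub> z) [] = ?l # w"
      using v zc \<rho>z[of "[]"] wr(1) act_Cons[OF lw] by (simp add: \<rho>(2,3))
    moreover have "\<rho> (z \<otimes>\<^bsub>A\<^esub> cls [?l]) [] = w @ [?l]"
      using v zc \<rho>z[OF wl l] act_Cons[OF l] by (simp add: \<rho>(2,3))
    moreover have "cls [?l] \<otimes>\<^bsub>A\<^esub> z = z \<otimes>\<^bsub>A\<^esub> cls [?l]"
      using z v unfolding central_def by (metis Cons_words Nil_words cls_closed fst_conv)
    ultimately have "?l # w = w @ [?l]" by simp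
    hence "hd w = ?l" using \<open>w \<noteq> []\<close> by (metis hd_append2 list.sel(1))
    thus False using v by auto
  qed
  thus ?thesis using that[of r] wr u by (simp add: cls_mult)
qed

text \<open>The blocks other than that of \<open>t\<close> are eliminated one at a time; no new
  letters appear, so an eliminated block does not return.\<close>

lemma central_word:
  assumes z: "central z"
  obtains u where "u \<in> words" "z = cls u" "\<And>l. l \<in> set u \<Longrightarrow> fst l = t"
proof -
  obtain u0 where u0: "u0 \<in> words" "z = cls u0"
    using z by (auto simp: central_def elim: carrierE)
  have "\<exists>u\<in>words. z = cls u \<and> (\<forall>l\<in>set u. blk (fst l) \<notin> blk ` F)"
    if "finite F" "F \<subseteq> V - {t}" for F
    using that
  proof (induction F rule: finite_induct)
    case empty
    show ?case using u0 by auto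
  next
    case (insert v F)
    then obtain u where u: "u \<in> words" "z = cls u" "\<forall>l\<in>set u. blk (fst l) \<notin> blk ` F" by auto
    obtain r where r: "r \<in> words" "z = cls r" "set r = {l \<in> set u. blk (fst l) \<noteq> blk v}"
      using central_avoids_block[OF z u(1,2), of v] insert.prems by blast
    thus ?case using u by (intro bexI[of _ r]) auto
  qed
  from this[of "V - {t}"] fin obtain u
    where u: "u \<in> words" "z = cls u" "\<forall>l\<in>set u. blk (fst l) \<notin> blk ` (V - {t})" by auto
  have "fst l = t" if "l \<in> set u" for l
    using that u by (force simp: raag_words_def)
  thus ?thesis using that u by blast
qed

lemma central_xt: "central (x t)"
proof -
  have "x t \<otimes>\<^bsub>A\<^esub> a = a \<otimes>\<^bsub>A\<^esub> x t" if "a \<in> carrier A" for a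
  proof -
    have gen: "x t \<otimes>\<^bsub>A\<^esub> x v = x v \<otimes>\<^bsub>A\<^esub> x t" if "v \<in> V" for v
      using that x_commute[of t v] blk_t[OF that] by (cases "v = t") (simp_all add: E_def, metis)
    from that show ?thesis
    proof (induction rule: carrier_induct)
      case (mult v a)
      thus ?case using gen[of v] by (metis A.m_assoc t_in x_closed)
    next
      case (inv_mult v a)
      thus ?case using commute_inv[OF A.is_group _ _ gen[of v, symmetric]]
        by (metis A.inv_closed A.m_assoc t_in x_closed)
    qed simp
  qed
  thus ?thesis by (simp add: central_def)
qed

lemma central_eq_pow:
  assumes z: "central z"
  obtains m :: int where "z = x t [^]\<^bsub>A\<^esub> m"
proof -
  obtain u where u: "u \<in> words" "z = cls u" "\<forall>l\<in>set u. fst l = t"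
    using central_word[OF z] by metis
  have "\<exists>m :: int. cls u = x t [^]\<^bsub>A\<^esub> m"
    using u(1,3)
  proof (induction u)
    case Nil
    show ?case by (rule exI[of _ 0]) (simp add: one_eq)
  next
    case (Cons l u)
    then obtain m :: int where m: "cls u = x t [^]\<^bsub>A\<^esub> m" by auto
    obtain b where "l = (t, b)" using Cons.prems(2) by (cases l) auto
    hence "cls (l # u) = x t [^]\<^bsub>A\<^esub> (if b then 1 else -1 :: int) \<otimes>\<^bsub>A\<^esub> x t [^]\<^bsub>A\<^esub> m"
      using cls_Cons[OF Cons.prems(1)] m by (simp add: cls_letter A.int_pow_neg)
    also have "\<dots> = x t [^]\<^bsub>A\<^esub> ((if b then 1 else -1) + m)"
      by (simp only: A.int_pow_mult x_closed t_in)
    finally show ?case by blast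
  qed
  thus ?thesis using that u(2) by auto
qed

subsection \<open>The action of automorphisms on the abelianization\<close>

lemma auto_group_hom: "\<alpha> \<in> auto A \<Longrightarrow> group_hom A A \<alpha>"
  by (simp add: group_hom_def group_hom_axioms_def A.is_group autoD(1))

text \<open>The matrix of \<open>\<alpha>\<close> on the abelianization, with row \<open>i\<close>
  and column \<open>v\<close>.\<close>

definition M :: "('v raag_word set \<Rightarrow> 'v raag_word set) \<Rightarrow> 'v \<Rightarrow> 'v \<Rightarrow> int"
  where "M \<alpha> i v = ex i (\<alpha> (x v))"

definition pw :: "int \<Rightarrow> 'v raag_word set"
  where "pw m = x t [^]\<^bsub>A\<^esub> m"

lemma pw_closed [simp]: "pw m \<in> carrier A"
  by (simp add: pw_def)

lemma pw_0 [simp]: "pw 0 = \<one>\<^bsub>A\<^esub>"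
  by (simp add: pw_def)

lemma pw_add: "pw (m + n) = pw m \<otimes>\<^bsub>A\<^esub> pw n"
  by (simp add: pw_def A.int_pow_mult)

lemma ex_pw [simp]: "ex i (pw m) = (if i = t then m else 0)"
  by (simp add: pw_def)

lemma pw_commute: "a \<in> carrier A \<Longrightarrow> pw m \<otimes>\<^bsub>A\<^esub> a = a \<otimes>\<^bsub>A\<^esub> pw m"
proof (induction m rule: int_induct[of _ 0])
  case (step1 m)
  have "x t \<otimes>\<^bsub>A\<^esub> a = a \<otimes>\<^bsub>A\<^esub> x t"
    using step1 central_xt by (simp add: central_def)
  moreover have "pw (m + 1) = pw m \<otimes>\<^bsub>A\<^esub> x t"
    by (simp add: pw_def A.int_pow_mult)
  ultimately show ?case
    using step1 by (metis A.m_assoc pw_closed t_in x_closed)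
next
  case (step2 m)
  have "inv\<^bsub>A\<^esub> x t \<otimes>\<^bsub>A\<^esub> a = a \<otimes>\<^bsub>A\<^esub> inv\<^bsub>A\<^esub> x t"
    using step2 central_xt by (intro commute_inv A.is_group) (auto simp: central_def)
  moreover have "pw (m - 1) = pw m \<otimes>\<^bsub>A\<^esub> inv\<^bsub>A\<^esub> x t"
    by (simp add: pw_def A.int_pow_diff)
  ultimately show ?case
    using step2 by (metis A.inv_closed A.m_assoc pw_closed t_in x_closed)
qed simp

text \<open>An automorphism preserves the centre, which is generated by \<open>x t\<close>, and acts
  on it by a unit of the integers.\<close>

lemma auto_xt:
  assumes \<alpha>: "\<alpha> \<in> auto A"
  shows "\<alpha> (x t) = pw (M \<alpha> t t)" and "M \<alpha> t t = 1 \<or> M \<alpha> t t = - 1"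
proof -
  have eq: "\<alpha> (x t) = pw (M \<alpha> t t)" if \<alpha>: "\<alpha> \<in> auto A" for \<alpha>
  proof -
    obtain \<beta> where \<beta>: "\<beta> \<in> auto A" "\<And>a. a \<in> carrier A \<Longrightarrow> \<alpha> (\<beta> a) = a"
      using A.auto_inverse[OF \<alpha>] by metis
    have "\<alpha> (x t) \<otimes>\<^bsub>A\<^esub> a = a \<otimes>\<^bsub>A\<^esub> \<alpha> (x t)" if "a \<in> carrier A" for a
    proof -
      have b: "\<beta> a \<in> carrier A" using auto_closed[OF \<beta>(1) that] .
      have "x t \<otimes>\<^bsub>A\<^esub> \<beta> a = \<beta> a \<otimes>\<^bsub>A\<^esub> x t"
        using b central_xt by (simp add: central_def)
      hence "\<alpha> (x t \<otimes>\<^bsub>A\<^esub> \<beta> a) = \<alpha> (\<beta> a \<otimes>\<^bsub>A\<^esub> x t)" by simp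
      thus ?thesis using b that by (simp add: auto_mult[OF \<alpha>] \<beta>(2))
    qed
    hence "central (\<alpha> (x t))"
      using auto_closed[OF \<alpha>, of "x t"] by (simp add: central_def)
    then obtain m where "\<alpha> (x t) = x t [^]\<^bsub>A\<^esub> (m :: int)" by (rule central_eq_pow)
    thus ?thesis by (simp add: M_def pw_def)
  qed
  show "\<alpha> (x t) = pw (M \<alpha> t t)" by (rule eq[OF \<alpha>])
  obtain \<beta> where \<beta>: "\<beta> \<in> auto A" "\<And>a. a \<in> carrier A \<Longrightarrow> \<alpha> (\<beta> a) = a"
    using A.auto_inverse[OF \<alpha>] by metis
  interpret a: group_hom A A \<alpha> by (rule auto_group_hom[OF \<alpha>])
  have "x t = \<alpha> (pw (M \<beta> t t))" using \<beta>(2)[of "x t"] eq[OF \<beta>(1)] by simp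
  also have "\<dots> = \<alpha> (x t) [^]\<^bsub>A\<^esub> M \<beta> t t" by (simp add: pw_def a.hom_int_pow)
  finally have "ex t (x t) = ex t (\<alpha> (x t) [^]\<^bsub>A\<^esub> M \<beta> t t)" by simp
  hence "M \<beta> t t * M \<alpha> t t = 1"
    using auto_closed[OF \<alpha>, of "x t"] by (simp add: M_def)
  thus "M \<alpha> t t = 1 \<or> M \<alpha> t t = - 1" by (auto simp: zmult_eq_1_iff)
qed

lemma auto_pw: "\<alpha> \<in> auto A \<Longrightarrow> \<alpha> (pw m) = pw (M \<alpha> t t * m)"
proof -
  assume \<alpha>: "\<alpha> \<in> auto A"
  interpret a: group_hom A A \<alpha> by (rule auto_group_hom[OF \<alpha>])
  have "\<alpha> (pw m) = pw (M \<alpha> t t) [^]\<^bsub>A\<^esub> m"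
    using auto_xt(1)[OF \<alpha>] by (simp add: pw_def[of m] a.hom_int_pow)
  thus ?thesis by (simp add: pw_def A.int_pow_pow)
qed

lemma M_t: "\<alpha> \<in> auto A \<Longrightarrow> i \<noteq> t \<Longrightarrow> M \<alpha> i t = 0"
  using auto_xt(1)[of \<alpha>] by (simp add: M_def[of _ i])

lemma ex_auto: "\<alpha> \<in> auto A \<Longrightarrow> a \<in> carrier A \<Longrightarrow> ex i (\<alpha> a) = (\<Sum>v\<in>V. M \<alpha> i v * ex v a)"
  unfolding M_def
  by (rule additive_eq_sum[OF fin]) (auto simp: auto_mult auto_closed)

lemma M_mult_inverse:
  assumes "\<alpha> \<in> auto A" "\<beta> \<in> auto A" "\<And>a. a \<in> carrier A \<Longrightarrow> \<alpha> (\<beta> a) = a" "v \<in> V"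
  shows "(\<Sum>u\<in>V. M \<alpha> i u * M \<beta> u v) = (if v = i then 1 else 0)"
  using ex_auto[OF assms(1), of "\<beta> (x v)" i] assms auto_closed[OF assms(2), of "x v"]
  by (simp add: M_def[of \<beta>])

text \<open>The two sides differ by \<open>m (a b) - m (b a)\<close> for the Magnus coefficient \<open>m\<close> of \<open>(i, j)\<close>.\<close>

lemma commute_minor:
  assumes "a \<in> carrier A" "b \<in> carrier A" "a \<otimes>\<^bsub>A\<^esub> b = b \<otimes>\<^bsub>A\<^esub> a" "blk i = blk j"
  shows "ex i a * ex j b = ex i b * ex j a"
proof (cases "i = j")
  case False
  obtain m where m: "\<And>a b. a \<in> carrier A \<Longrightarrow> b \<in> carrier A \<Longrightarrow>
      m (a \<otimes>\<^bsub>A\<^esub> b) = m a + m b + ex i a * ex j b" "\<And>v. v \<in> V \<Longrightarrow> m (x v) = (0::int)"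
    by (rule magnus_coefficient[OF False]) (use assms(4) in \<open>auto simp: E_def\<close>)
  show ?thesis using m(1)[of a b] m(1)[of b a] assms by simp
qed simp

text \<open>Images of adjacent generators commute, so \<open>commute_minor\<close> applies: within
  the rows of one block, columns from different blocks are proportional.\<close>

lemma M_minor:
  assumes "\<alpha> \<in> auto A" "v \<in> V" "w \<in> V" "blk v \<noteq> blk w" "blk i = blk j"
  shows "M \<alpha> i v * M \<alpha> j w = M \<alpha> i w * M \<alpha> j v"
proof -
  have "x v \<otimes>\<^bsub>A\<^esub> x w = x w \<otimes>\<^bsub>A\<^esub> x v"
    using assms by (intro x_commute) (auto simp: E_def)
  hence "\<alpha> (x v) \<otimes>\<^bsub>A\<^esub> \<alpha> (x w) = \<alpha> (x w) \<otimes>\<^bsub>A\<^esub> \<alpha> (x v)"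
    using assms auto_mult[of \<alpha> A] by (metis x_closed)
  thus ?thesis
    unfolding M_def using assms by (intro commute_minor) (auto simp: auto_closed)
qed

text \<open>If two column blocks met the row block of \<open>i\<close>, all columns would be proportional there, and the
  matrix could not be invertible.\<close>

lemma M_row_block:
  assumes \<alpha>: "\<alpha> \<in> auto A" and V: "i \<in> V" "j \<in> V" "i \<noteq> t" "blk i = blk j" "v \<in> V" "w \<in> V"
    and nz: "M \<alpha> i v \<noteq> 0" "M \<alpha> j w \<noteq> 0"
  shows "blk v = blk w"
proof (rule ccontr)
  assume vw: "blk v \<noteq> blk w"
  obtain \<beta> where \<beta>: "\<beta> \<in> auto A" "\<And>a. a \<in> carrier A \<Longrightarrow> \<alpha> (\<beta> a) = a"
    using A.auto_inverse[OF \<alpha>] by metis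
  \<comment> \<open>The minor of rows \<open>i\<close>, \<open>j\<close> and columns
    \<open>v\<close>, \<open>w\<close> vanishes, so its nonzero diagonal product forces nonzero
    off-diagonal entries.\<close>
  have iw: "M \<alpha> i w \<noteq> 0"
    using M_minor[OF \<alpha> V(5,6) vw V(4)] nz by auto
  obtain l where l: "l \<in> V" "blk l = blk i" "l \<noteq> i"
    using card_ge_3_avoid[OF card_block[OF V(1,3)], of i i] by auto
  \<comment> \<open>A column outside the block of \<open>v\<close> is compared with \<open>v\<close>
    directly; a column inside it, and \<open>v\<close> itself, are compared with \<open>w\<close>,
    and \<open>M \<alpha> i w\<close> is cancelled.\<close>
  have par: "M \<alpha> l u * M \<alpha> i v = M \<alpha> i u * M \<alpha> l v" if u: "u \<in> V" for u
  proof (cases "blk u = blk v")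
    case False
    thus ?thesis using M_minor[OF \<alpha> u V(5), of l i] l by (simp add: mult.commute)
  next
    case True
    have "M \<alpha> l u * M \<alpha> i w = M \<alpha> l w * M \<alpha> i u"
      using M_minor[OF \<alpha> u V(6), of l i] l vw True by simp
    moreover have "M \<alpha> l v * M \<alpha> i w = M \<alpha> l w * M \<alpha> i v"
      using M_minor[OF \<alpha> V(5,6) vw, of l i] l by simp
    ultimately have "(M \<alpha> l u * M \<alpha> i v) * M \<alpha> i w = (M \<alpha> i u * M \<alpha> l v) * M \<alpha> i w"
      by (simp add: algebra_simps)
    thus ?thesis using iw by simp
  qed
  \<comment> \<open>Row \<open>l\<close> is proportional to row \<open>i\<close>, but against column
    \<open>l\<close> of the inverse they give 1 and 0.\<close>
  have "M \<alpha> i v = (\<Sum>u\<in>V. M \<alpha> l u * M \<beta> u l) * M \<alpha> i v"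
    using M_mult_inverse[OF \<alpha> \<beta> l(1), of l] by simp
  also have "\<dots> = (\<Sum>u\<in>V. (M \<alpha> l u * M \<alpha> i v) * M \<beta> u l)"
    by (simp add: sum_distrib_left sum_distrib_right algebra_simps)
  also have "\<dots> = (\<Sum>u\<in>V. (M \<alpha> i u * M \<alpha> l v) * M \<beta> u l)"
    by (rule sum.cong) (auto simp: par)
  also have "\<dots> = (\<Sum>u\<in>V. M \<alpha> i u * M \<beta> u l) * M \<alpha> l v"
    by (simp add: sum_distrib_left sum_distrib_right algebra_simps)
  also have "\<dots> = 0"
    using M_mult_inverse[OF \<alpha> \<beta> l(1), of i] l by simp
  finally show False using nz by simp
qed

text \<open>With \<open>P = M \<alpha>\<close> and \<open>Q = P\<inverse>\<close>, the trace of \<open>P Q\<close> over a row block equals the trace of \<open>Q P\<close> over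
  the column block it meets, so these blocks have the same size and hence coincide.\<close>

lemma M_block_diagonal:
  assumes \<alpha>: "\<alpha> \<in> auto A" and i: "i \<in> V" "i \<noteq> t" and v: "v \<in> V" "M \<alpha> i v \<noteq> 0"
  shows "blk v = blk i"
proof -
  obtain \<beta> where \<beta>: "\<beta> \<in> auto A" "\<And>a. a \<in> carrier A \<Longrightarrow> \<alpha> (\<beta> a) = a"
    "\<And>a. a \<in> carrier A \<Longrightarrow> \<beta> (\<alpha> a) = a"
    using A.auto_inverse[OF \<alpha>] by metis
  \<comment> \<open>Some summand of this diagonal entry is nonzero. Its index \<open>u\<close>
    singles out the column block, and as both factors are nonzero, \<open>M_row_block\<close>
    applies to \<open>\<alpha>\<close> in row \<open>i\<close> and to \<open>\<beta>\<close> in row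
    \<open>u\<close>.\<close>
  have "(\<Sum>u\<in>V. M \<alpha> i u * M \<beta> u i) \<noteq> 0"
    using M_mult_inverse[OF \<alpha> \<beta>(1,2) i(1), of i] by simp
  then obtain u where u: "u \<in> V" "M \<alpha> i u \<noteq> 0" "M \<beta> u i \<noteq> 0"
    by (metis (no_types, lifting) mult_eq_0_iff sum.neutral)
  have "u \<noteq> t" using M_t[OF \<alpha> i(2)] u(2) by metis
  define B where "B = {k \<in> V. blk k = blk i}"
  define C where "C = {k \<in> V. blk k = blk u}"
  have fBC: "finite B" "finite C" "B \<subseteq> V" "C \<subseteq> V" using fin by (auto simp: B_def C_def)
  have "int (card B) = (\<Sum>k\<in>B. \<Sum>l\<in>V. M \<alpha> k l * M \<beta> l k)"
    using M_mult_inverse[OF \<alpha> \<beta>(1,2)] by (simp add: B_def)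
  also have "\<dots> = (\<Sum>k\<in>B. \<Sum>l\<in>C. M \<alpha> k l * M \<beta> l k)"
  proof (rule sum.cong[OF HOL.refl])
    fix k assume k: "k \<in> B"
    show "(\<Sum>l\<in>V. M \<alpha> k l * M \<beta> l k) = (\<Sum>l\<in>C. M \<alpha> k l * M \<beta> l k)"
    proof (rule sum.mono_neutral_right[OF fin fBC(4)], rule ballI)
      fix l assume "l \<in> V - C"
      thus "M \<alpha> k l * M \<beta> l k = 0"
        using M_row_block[OF \<alpha> i(1) _ i(2) _ u(1) _ u(2), of k l] k by (auto simp: B_def C_def)
    qed
  qed
  also have "\<dots> = (\<Sum>l\<in>C. \<Sum>k\<in>B. M \<alpha> k l * M \<beta> l k)"
    by (rule sum.swap)
  also have "\<dots> = (\<Sum>l\<in>C. \<Sum>k\<in>V. M \<beta> l k * M \<alpha> k l)"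
  proof (rule sum.cong[OF HOL.refl])
    fix l assume l: "l \<in> C"
    have "(\<Sum>k\<in>V. M \<beta> l k * M \<alpha> k l) = (\<Sum>k\<in>B. M \<beta> l k * M \<alpha> k l)"
    proof (rule sum.mono_neutral_right[OF fin fBC(3)], rule ballI)
      fix k assume "k \<in> V - B"
      thus "M \<beta> l k * M \<alpha> k l = 0"
        using M_row_block[OF \<beta>(1) u(1) _ \<open>u \<noteq> t\<close> _ i(1) _ u(3), of l k] l by (auto simp: B_def C_def)
    qed
    thus "(\<Sum>k\<in>B. M \<alpha> k l * M \<beta> l k) = (\<Sum>k\<in>V. M \<beta> l k * M \<alpha> k l)"
      by (simp add: mult.commute)
  qed
  also have "\<dots> = int (card C)"
    using M_mult_inverse[OF \<beta>(1) \<alpha> \<beta>(3)] by (simp add: C_def)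
  finally have "blk i = blk u"
    using card_inj[OF i(1) u(1)] by (simp add: B_def C_def)
  thus ?thesis
    using M_row_block[OF \<alpha> i(1) i(1) i(2) HOL.refl v(1) u(1) v(2) u(2)] by simp
qed

subsection \<open>Twisting automorphisms by signs\<close>

text \<open>\<open>dev c \<alpha> a\<close> is the exponent \<open>h(c a - a)\<close> of the introduction, with \<open>c\<close> acting on the
  abelianization.\<close>

definition dev :: "('k \<Rightarrow> int) \<Rightarrow> ('v raag_word set \<Rightarrow> 'v raag_word set) \<Rightarrow> 'v raag_word set \<Rightarrow> int"
  where "dev c \<alpha> a = (\<Sum>v\<in>V. (c (blk v) - 1) * M \<alpha> t v * ex v a)"

definition twist :: "('k \<Rightarrow> int) \<Rightarrow> ('v raag_word set \<Rightarrow> 'v raag_word set)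
    \<Rightarrow> 'v raag_word set \<Rightarrow> 'v raag_word set"
  where "twist c \<alpha> = (\<lambda>a\<in>carrier A. \<alpha> a \<otimes>\<^bsub>A\<^esub> pw (dev c \<alpha> a))"

lemma dev_mult [simp]:
  "a \<in> carrier A \<Longrightarrow> b \<in> carrier A \<Longrightarrow> dev c \<alpha> (a \<otimes>\<^bsub>A\<^esub> b) = dev c \<alpha> a + dev c \<alpha> b"
  by (simp add: dev_def distrib_left sum.distrib)

lemma dev_pw: "c (blk t) = 1 \<Longrightarrow> dev c \<alpha> (pw m) = 0"
  unfolding dev_def by (rule sum.neutral) simp

lemma dev_x: "v \<in> V \<Longrightarrow> dev c \<alpha> (x v) = (c (blk v) - 1) * M \<alpha> t v"
  using fin by (simp add: dev_def if_distrib sum.delta cong: if_cong)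

lemma dev_eq_0:
  assumes "c (blk t) = 1" "\<And>v. v \<in> V \<Longrightarrow> v \<noteq> t \<Longrightarrow> M \<alpha> t v = 0"
  shows "dev c \<alpha> a = 0"
  unfolding dev_def using assms by (intro sum.neutral) force

lemma twist_hom:
  assumes \<alpha>: "\<alpha> \<in> auto A"
  shows "twist c \<alpha> \<in> hom A A"
proof (rule homI)
  fix a b assume ab: "a \<in> carrier A" "b \<in> carrier A"
  note closed = auto_closed[OF \<alpha> ab(1)] auto_closed[OF \<alpha> ab(2)]
  show "twist c \<alpha> (a \<otimes>\<^bsub>A\<^esub> b) = twist c \<alpha> a \<otimes>\<^bsub>A\<^esub> twist c \<alpha> b"
    using ab closed pw_commute[OF closed(2), of "dev c \<alpha> a"]
    by (simp add: twist_def auto_mult[OF \<alpha>] pw_add A.m_assoc)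
      (metis A.m_assoc A.m_closed pw_closed)
qed (auto simp: twist_def auto_closed[OF \<alpha>])

lemma M_compose:
  assumes "\<alpha> \<in> auto A" "\<beta> \<in> auto A" "v \<in> V"
  shows "M (compose (carrier A) \<alpha> \<beta>) i v = (\<Sum>u\<in>V. M \<alpha> i u * M \<beta> u v)"
  using assms ex_auto[OF assms(1), of "\<beta> (x v)" i] auto_closed[OF assms(2), of "x v"]
  by (simp add: M_def[of "compose _ _ _"] compose_eq) (simp add: M_def)

text \<open>The cocycle rule that makes \<open>twist c\<close> multiplicative.\<close>

lemma dev_compose:
  assumes c: "c (blk t) = 1" and \<alpha>: "\<alpha> \<in> auto A" and \<beta>: "\<beta> \<in> auto A" and a: "a \<in> carrier A"
  shows "dev c (compose (carrier A) \<alpha> \<beta>) a = M \<alpha> t t * dev c \<beta> a + dev c \<alpha> (\<beta> a)"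
proof -
  let ?c = "\<lambda>v. c (blk v) - 1"
  have "dev c (compose (carrier A) \<alpha> \<beta>) a
      = (\<Sum>v\<in>V. \<Sum>u\<in>V. ?c v * M \<alpha> t u * M \<beta> u v * ex v a)"
    by (simp add: dev_def M_compose[OF \<alpha> \<beta>] sum_distrib_left sum_distrib_right mult.assoc)
  \<comment> \<open>For \<open>u\<close> other than \<open>t\<close>, a nonzero
    \<open>M \<beta> u v\<close> puts \<open>u\<close> and \<open>v\<close> into one block, so the
    sign of \<open>v\<close> can be replaced by that of \<open>u\<close>. Row \<open>t\<close> of
    \<open>M \<beta>\<close> is unrestricted and is split off; its second term vanishes because
    \<open>c\<close> is 1 there.\<close>
  also have "\<dots> = (\<Sum>v\<in>V. \<Sum>u\<in>V. (if u = t then M \<alpha> t t * (?c v * M \<beta> t v * ex v a) else 0)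
      + ?c u * M \<alpha> t u * (M \<beta> u v * ex v a))"
  proof (intro sum.cong[OF HOL.refl])
    fix v u assume vu: "v \<in> V" "u \<in> V"
    show "?c v * M \<alpha> t u * M \<beta> u v * ex v a
      = (if u = t then M \<alpha> t t * (?c v * M \<beta> t v * ex v a) else 0)
        + ?c u * M \<alpha> t u * (M \<beta> u v * ex v a)"
      using M_block_diagonal[OF \<beta> vu(2) _ vu(1)] c by (cases "M \<beta> u v = 0") auto
  qed
  also have "\<dots> = M \<alpha> t t * dev c \<beta> a + (\<Sum>v\<in>V. \<Sum>u\<in>V. ?c u * M \<alpha> t u * (M \<beta> u v * ex v a))"
    using fin by (simp add: sum.distrib sum.delta dev_def sum_distrib_left)
  also have "(\<Sum>v\<in>V. \<Sum>u\<in>V. ?c u * M \<alpha> t u * (M \<beta> u v * ex v a)) = dev c \<alpha> (\<beta> a)"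
    by (subst sum.swap) (simp add: dev_def ex_auto[OF \<beta> a] sum_distrib_left)
  finally show ?thesis .
qed

text \<open>Pushing the central factor of \<open>twist c \<beta>\<close> through
  \<open>\<alpha>\<close> multiplies its exponent by \<open>M \<alpha> t t\<close>, as in
  \<open>dev_compose\<close>; by \<open>dev_pw\<close> it causes no further twist.\<close>

lemma twist_compose:
  assumes c: "c (blk t) = 1" and \<alpha>: "\<alpha> \<in> auto A" and \<beta>: "\<beta> \<in> auto A"
  shows "twist c (compose (carrier A) \<alpha> \<beta>) = compose (carrier A) (twist c \<alpha>) (twist c \<beta>)"
proof
  fix a
  show "twist c (compose (carrier A) \<alpha> \<beta>) a = compose (carrier A) (twist c \<alpha>) (twist c \<beta>) a"
  proof (cases "a \<in> carrier A")
    case True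
    have b: "\<beta> a \<in> carrier A" "\<alpha> (\<beta> a) \<in> carrier A"
      using True \<alpha> \<beta> by (auto simp: auto_closed)
    have "twist c \<alpha> (twist c \<beta> a)
        = \<alpha> (\<beta> a) \<otimes>\<^bsub>A\<^esub> pw (M \<alpha> t t * dev c \<beta> a) \<otimes>\<^bsub>A\<^esub> pw (dev c \<alpha> (\<beta> a))"
      using True b by (simp add: twist_def auto_mult[OF \<alpha>] auto_pw[OF \<alpha>] dev_pw[where c = c, OF c])
    also have "\<dots> = twist c (compose (carrier A) \<alpha> \<beta>) a"
      using True b dev_compose[where c = c, OF c \<alpha> \<beta> True]
      by (simp add: twist_def compose_eq pw_add A.m_assoc)
    finally show ?thesis using True by (simp add: compose_eq)
  qed (simp add: twist_def compose_def)
qed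

text \<open>\<open>dev\<close> sees only row \<open>t\<close> outside column \<open>t\<close>. This
  covers the identity, inner automorphisms and partial conjugations.\<close>

lemma twist_fixed:
  assumes "c (blk t) = 1" "\<alpha> \<in> auto A" "\<And>v. v \<in> V \<Longrightarrow> v \<noteq> t \<Longrightarrow> M \<alpha> t v = 0"
  shows "twist c \<alpha> = \<alpha>"
proof
  fix a
  have "dev c \<alpha> a = 0" using assms(1,3) by (rule dev_eq_0)
  thus "twist c \<alpha> a = \<alpha> a"
    using assms(2) autoD(2)[OF assms(2)] by (auto simp: twist_def auto_closed extensional_def)
qed

text \<open>Since \<open>twist c\<close> is multiplicative and fixes the identity, twisting the
  inverse of \<open>\<alpha>\<close> yields an inverse.\<close>

lemma twist_auto:
  assumes c: "c (blk t) = 1" and \<alpha>: "\<alpha> \<in> auto A"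
  shows "twist c \<alpha> \<in> auto A"
proof -
  obtain \<beta> where \<beta>: "\<beta> \<in> auto A" "\<And>a. a \<in> carrier A \<Longrightarrow> \<alpha> (\<beta> a) = a"
    "\<And>a. a \<in> carrier A \<Longrightarrow> \<beta> (\<alpha> a) = a"
    using A.auto_inverse[OF \<alpha>] by metis
  let ?id = "\<lambda>a\<in>carrier A. a"
  have id: "twist c ?id = ?id"
    by (rule twist_fixed[where c = c, OF c A.id_in_auto]) (simp add: M_def)
  have "compose (carrier A) \<alpha> \<beta> = ?id" "compose (carrier A) \<beta> \<alpha> = ?id"
    using \<beta> by (simp_all add: compose_def cong: restrict_cong)
  hence *: "compose (carrier A) (twist c \<alpha>) (twist c \<beta>) = ?id"
    "compose (carrier A) (twist c \<beta>) (twist c \<alpha>) = ?id"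
    using twist_compose[where c = c, OF c \<alpha> \<beta>(1)] twist_compose[where c = c, OF c \<beta>(1) \<alpha>] id by simp_all
  show ?thesis
  proof (rule autoI)
    show "twist c \<beta> \<in> carrier A \<rightarrow> carrier A"
      using twist_hom[OF \<beta>(1), of c] by (auto simp: hom_def)
    show "twist c \<alpha> (twist c \<beta> a) = a" if "a \<in> carrier A" for a
      using fun_cong[OF *(1), of a] that by (simp add: compose_eq)
    show "twist c \<beta> (twist c \<alpha> a) = a" if "a \<in> carrier A" for a
      using fun_cong[OF *(2), of a] that by (simp add: compose_eq)
    show "twist c \<alpha> \<in> hom A A" by (rule twist_hom[OF \<alpha>])
  qed (simp add: twist_def)
qed

text \<open>Twisting multiplies row \<open>t\<close> by the signs, so the exponents inserted by two
  twists add up to a multiple of \<open>(c - 1) + (c - 1) c = c^2 - 1 = 0\<close>.\<close>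

lemma twist_twist:
  assumes c: "c (blk t) = 1" "\<And>k. c k * c k = 1" and \<alpha>: "\<alpha> \<in> auto A"
  shows "twist c (twist c \<alpha>) = \<alpha>"
proof
  fix a
  show "twist c (twist c \<alpha>) a = \<alpha> a"
  proof (cases "a \<in> carrier A")
    case True
    have M: "M (twist c \<alpha>) t v = c (blk v) * M \<alpha> t v" if v: "v \<in> V" for v
    proof -
      have "M (twist c \<alpha>) t v = M \<alpha> t v + dev c \<alpha> (x v)"
        using v auto_closed[OF \<alpha>, of "x v"] by (simp add: M_def twist_def)
      thus ?thesis by (simp add: dev_x[OF v] algebra_simps)
    qed
    have "(c k - 1) * (1 + c k) = 0" for k
      using c(2)[of k] by (simp add: algebra_simps)
    hence "(c k - 1) * m * n + (c k - 1) * (c k * m) * n = 0" for k m n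
      by (metis (no_types, opaque_lifting) distrib_left distrib_right mult.assoc mult.commute mult_1 mult_zero_right)
    hence "dev c \<alpha> a + dev c (twist c \<alpha>) a = 0"
      by (simp add: dev_def M flip: sum.distrib)
    thus ?thesis
      using True auto_closed[OF \<alpha> True] by (simp add: twist_def A.m_assoc flip: pw_add)
  qed (use autoD(2)[OF \<alpha>] in \<open>simp add: twist_def extensional_def\<close>)
qed

lemma twist_inner:
  assumes "c (blk t) = 1" "f \<in> inner_auts A"
  shows "twist c f = f"
proof -
  obtain g where g: "g \<in> carrier A" "f = A.conj_by g"
    using assms(2) by (auto simp: A.inner_auts_eq)
  show ?thesis
    using assms(1) A.conj_by_auto[OF g(1)] g
    by (intro twist_fixed) (auto simp: M_def A.conj_by_def)
qed

subsection \<open>Transvections and partial conjugations\<close>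

definition transvection :: "'v \<Rightarrow> 'v raag_word set \<Rightarrow> 'v raag_word set"
  where "transvection i = (\<lambda>a\<in>carrier A. a \<otimes>\<^bsub>A\<^esub> pw (ex i a))"

lemma transvection_auto:
  assumes "i \<noteq> t"
  shows "transvection i \<in> auto A"
proof (rule autoI[where g = "\<lambda>a. a \<otimes>\<^bsub>A\<^esub> pw (- ex i a)"])
  show "transvection i \<in> hom A A"
  proof (rule homI)
    fix a b assume "a \<in> carrier A" "b \<in> carrier A"
    thus "transvection i (a \<otimes>\<^bsub>A\<^esub> b) = transvection i a \<otimes>\<^bsub>A\<^esub> transvection i b"
      using pw_commute[of b "ex i a"]
      by (simp add: transvection_def pw_add A.m_assoc) (metis A.m_assoc A.m_closed pw_closed)
  qed (simp add: transvection_def)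
qed (use assms in \<open>auto simp: transvection_def A.m_assoc simp flip: pw_add\<close>)

text \<open>Apart from column \<open>t\<close>, where \<open>c\<close> is 1, row \<open>t\<close>
  has the single nonzero entry 1 at \<open>i\<close>; so the exponent is multiplied by
  \<open>1 + (c - 1) = c\<close>.\<close>

lemma twist_transvection:
  assumes "c (blk t) = 1" "i \<in> V" "i \<noteq> t" "a \<in> carrier A"
  shows "twist c (transvection i) a = a \<otimes>\<^bsub>A\<^esub> pw (c (blk i) * ex i a)"
proof -
  have M: "M (transvection i) t v = (if v = t then 1 else 0) + (if v = i then 1 else 0)" if "v \<in> V" for v
    using that by (simp add: M_def transvection_def)
  have "dev c (transvection i) a = (\<Sum>v\<in>V. if v = i then (c (blk i) - 1) * ex i a else 0)"
    unfolding dev_def using assms by (intro sum.cong[OF HOL.refl]) (auto simp: M)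
  also have "\<dots> = (c (blk i) - 1) * ex i a"
    using fin assms by simp
  finally have "dev c (transvection i) a = (c (blk i) - 1) * ex i a" .
  thus ?thesis
    using assms(4) by (simp add: twist_def transvection_def A.m_assoc algebra_simps flip: pw_add)
qed

text \<open>The relations at \<open>x0\<close> involve only vertices of other blocks, which commute
  with \<open>g\<close> and with \<open>x x0\<close>. A general \<open>g\<close> allows both
  \<open>x y\<close> and its inverse.\<close>

lemma partial_conjugation_hom:
  assumes x0: "x0 \<in> V" and g: "g \<in> carrier A"
    and comm: "\<And>w. w \<in> V \<Longrightarrow> blk w \<noteq> blk x0 \<Longrightarrow> g \<otimes>\<^bsub>A\<^esub> x w = x w \<otimes>\<^bsub>A\<^esub> g"
  obtains \<phi> where "\<phi> \<in> hom A A" "\<phi> (x x0) = g \<otimes>\<^bsub>A\<^esub> x x0 \<otimes>\<^bsub>A\<^esub> inv\<^bsub>A\<^esub> g"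
    "\<And>v. v \<in> V \<Longrightarrow> v \<noteq> x0 \<Longrightarrow> \<phi> (x v) = x v"
proof -
  let ?f = "\<lambda>v. if v = x0 then g \<otimes>\<^bsub>A\<^esub> x x0 \<otimes>\<^bsub>A\<^esub> inv\<^bsub>A\<^esub> g else x v"
  have *: "?f x0 \<otimes>\<^bsub>A\<^esub> x w = x w \<otimes>\<^bsub>A\<^esub> ?f x0" if w: "w \<in> V" "blk w \<noteq> blk x0" for w
  proof -
    have 1: "g \<otimes>\<^bsub>A\<^esub> x w = x w \<otimes>\<^bsub>A\<^esub> g" by (rule comm[OF w])
    have 2: "inv\<^bsub>A\<^esub> g \<otimes>\<^bsub>A\<^esub> x w = x w \<otimes>\<^bsub>A\<^esub> inv\<^bsub>A\<^esub> g"
      using g w by (intro commute_inv[OF A.is_group _ _ 1]) auto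
    have 3: "x x0 \<otimes>\<^bsub>A\<^esub> x w = x w \<otimes>\<^bsub>A\<^esub> x x0"
      using w x0 by (intro x_commute) (auto simp: E_def)
    have "?f x0 \<otimes>\<^bsub>A\<^esub> x w = g \<otimes>\<^bsub>A\<^esub> (x x0 \<otimes>\<^bsub>A\<^esub> x w) \<otimes>\<^bsub>A\<^esub> inv\<^bsub>A\<^esub> g"
      using g w x0 by (simp add: A.m_assoc 2)
    also have "\<dots> = (g \<otimes>\<^bsub>A\<^esub> x w) \<otimes>\<^bsub>A\<^esub> x x0 \<otimes>\<^bsub>A\<^esub> inv\<^bsub>A\<^esub> g"
      using g w x0 by (simp add: A.m_assoc 3)
    also have "\<dots> = x w \<otimes>\<^bsub>A\<^esub> ?f x0"
      unfolding 1 using g w x0 by (simp add: A.m_assoc)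
    finally show ?thesis .
  qed
  obtain \<phi> where "\<phi> \<in> hom A A" "\<And>v. v \<in> V \<Longrightarrow> \<phi> (x v) = ?f v"
  proof (rule hom_extension[OF A.is_group, of ?f])
    fix v w assume vw: "v \<in> V" "w \<in> V" "E v w"
    consider "v = x0" "w \<noteq> x0" | "w = x0" "v \<noteq> x0" | "v \<noteq> x0" "w \<noteq> x0"
      using vw by (auto simp: E_def)
    thus "?f v \<otimes>\<^bsub>A\<^esub> ?f w = ?f w \<otimes>\<^bsub>A\<^esub> ?f v"
    proof cases
      case 1
      thus ?thesis using *[of w] vw by (simp add: E_def)
    next
      case 2
      thus ?thesis using *[of v] vw by (simp add: E_def)
    next
      case 3
      thus ?thesis using x_commute[OF vw(3,1,2)] by simp
    qed
  qed (use g x0 in auto)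
  thus ?thesis using that[of \<phi>] x0 by simp
qed

lemma partial_conjugation:
  assumes V: "y \<in> V" "x0 \<in> V" "blk y = blk x0" "y \<noteq> x0"
  obtains p where "p \<in> auto A" "p (x x0) = x y \<otimes>\<^bsub>A\<^esub> x x0 \<otimes>\<^bsub>A\<^esub> inv\<^bsub>A\<^esub> x y"
    "\<And>v. v \<in> V \<Longrightarrow> v \<noteq> x0 \<Longrightarrow> p (x v) = x v"
proof -
  have comm: "x y \<otimes>\<^bsub>A\<^esub> x w = x w \<otimes>\<^bsub>A\<^esub> x y" if "w \<in> V" "blk w \<noteq> blk x0" for w
    using that V by (intro x_commute) (auto simp: E_def)
  obtain \<phi> where \<phi>: "\<phi> \<in> hom A A" "\<phi> (x x0) = x y \<otimes>\<^bsub>A\<^esub> x x0 \<otimes>\<^bsub>A\<^esub> inv\<^bsub>A\<^esub> x y"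
    "\<And>v. v \<in> V \<Longrightarrow> v \<noteq> x0 \<Longrightarrow> \<phi> (x v) = x v"
    by (rule partial_conjugation_hom[OF V(2) x_closed[OF V(1)] comm]) (assumption+, rule that)
  have comm': "inv\<^bsub>A\<^esub> x y \<otimes>\<^bsub>A\<^esub> x w = x w \<otimes>\<^bsub>A\<^esub> inv\<^bsub>A\<^esub> x y" if "w \<in> V" "blk w \<noteq> blk x0" for w
    using V that by (intro commute_inv[OF A.is_group _ _ comm]) auto
  obtain \<psi> where \<psi>: "\<psi> \<in> hom A A" "\<psi> (x x0) = inv\<^bsub>A\<^esub> x y \<otimes>\<^bsub>A\<^esub> x x0 \<otimes>\<^bsub>A\<^esub> inv\<^bsub>A\<^esub> (inv\<^bsub>A\<^esub> x y)"
    "\<And>v. v \<in> V \<Longrightarrow> v \<noteq> x0 \<Longrightarrow> \<psi> (x v) = x v"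
    by (rule partial_conjugation_hom[OF V(2) A.inv_closed[OF x_closed[OF V(1)]] comm'])
      (assumption+, rule that)
  interpret f: group_hom A A \<phi>
    by (simp add: group_hom_def group_hom_axioms_def A.is_group \<phi>(1))
  interpret g: group_hom A A \<psi>
    by (simp add: group_hom_def group_hom_axioms_def A.is_group \<psi>(1))
  have id: "(\<lambda>a. a) \<in> hom A A" by (simp add: hom_def)
  \<comment> \<open>Both maps fix \<open>x y\<close> because \<open>y\<close> differs from
    \<open>x0\<close>, so the two conjugations of \<open>x x0\<close> cancel.\<close>
  have "\<phi> (\<psi> (x v)) = x v \<and> \<psi> (\<phi> (x v)) = x v" if v: "v \<in> V" for v
    using V v \<phi>(2,3) \<psi>(2,3) by (cases "v = x0") (simp_all add: A.m_assoc)
  hence "\<phi> (\<psi> a) = a" "\<psi> (\<phi> a) = a" if "a \<in> carrier A" for a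
    using hom_unique[OF A.is_group hom_compose[OF \<psi>(1) \<phi>(1)] id _ that]
      hom_unique[OF A.is_group hom_compose[OF \<phi>(1) \<psi>(1)] id _ that] by simp_all
  hence "restrict \<phi> (carrier A) \<in> auto A"
    using \<phi>(1) by (intro autoI[of _ _ \<psi>]) (auto simp: hom_def)
  thus ?thesis
    using \<phi>(2,3) V by (intro that[of "restrict \<phi> (carrier A)"]) auto
qed

text \<open>The contributions of \<open>a\<close> and its inverse cancel up to products of
  exponents. What remains is an alternating form, which detects exponents of a conjugating
  element.\<close>

lemma magnus_conj:
  assumes m: "\<And>a b. a \<in> carrier A \<Longrightarrow> b \<in> carrier A \<Longrightarrow>
      m (a \<otimes>\<^bsub>A\<^esub> b) = m a + m b + ex i a * ex j b"
    and ab: "a \<in> carrier A" "b \<in> carrier A"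
  shows "m (a \<otimes>\<^bsub>A\<^esub> b \<otimes>\<^bsub>A\<^esub> inv\<^bsub>A\<^esub> a) = (m b + ex i a * ex j b - ex i b * ex j a :: int)"
proof -
  have "m \<one>\<^bsub>A\<^esub> = 0" using m[of "\<one>\<^bsub>A\<^esub>" "\<one>\<^bsub>A\<^esub>"] by simp
  hence "m a + m (inv\<^bsub>A\<^esub> a) - ex i a * ex j a = 0"
    using m[of a "inv\<^bsub>A\<^esub> a"] ab by simp
  moreover have "m (a \<otimes>\<^bsub>A\<^esub> b \<otimes>\<^bsub>A\<^esub> inv\<^bsub>A\<^esub> a)
      = m a + m b + ex i a * ex j b + m (inv\<^bsub>A\<^esub> a) + (ex i a + ex i b) * - ex j a"
    using m[of "a \<otimes>\<^bsub>A\<^esub> b" "inv\<^bsub>A\<^esub> a"] m[of a b] ab by simp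
  ultimately show ?thesis by (simp add: algebra_simps)
qed

text \<open>If \<open>g\<close> acts by \<open>-1\<close> on the abelianization of a free factor, then modulo third commutators it
  acts by \<open>+1\<close> on the commutators of that factor, so it conjugates the partial conjugation \<open>p\<close> to
  \<open>p\<inverse>\<close> up to an inner automorphism and cannot commute with it in \<open>Out A\<close>. With the Magnus
  coefficients \<open>m\<close> for \<open>(y, i0)\<close> and \<open>n\<close> for \<open>(y, z)\<close>, the inner automorphism by \<open>w\<close> would need \<open>y\<close>-exponent
  \<open>2\<close> because of \<open>m\<close> and \<open>0\<close> because of \<open>n\<close>.\<close>

lemma inversion_not_central:
  assumes g: "g \<in> auto A" and i0: "i0 \<in> V" "i0 \<noteq> t"
    and neg: "\<And>i a. blk i = blk i0 \<Longrightarrow> i \<in> V \<Longrightarrow> a \<in> carrier A \<Longrightarrow> ex i (g a) = - ex i a"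
  obtains p where "p \<in> auto A" "\<And>v. v \<in> V \<Longrightarrow> v \<noteq> t \<Longrightarrow> M p t v = 0"
    "\<not> (\<exists>w\<in>carrier A. \<forall>a\<in>carrier A. p (g a) = w \<otimes>\<^bsub>A\<^esub> g (p a) \<otimes>\<^bsub>A\<^esub> inv\<^bsub>A\<^esub> w)"
proof -
  note card3 = card_ge_3_avoid[OF card_block[OF i0]]
  obtain y where y: "y \<in> V" "blk y = blk i0" "y \<noteq> i0"
    using card3[of i0 i0] by auto
  obtain z where z: "z \<in> V" "blk z = blk i0" "z \<noteq> i0" "z \<noteq> y"
    using card3[of i0 y] by auto
  obtain p where p: "p \<in> auto A" "p (x i0) = x y \<otimes>\<^bsub>A\<^esub> x i0 \<otimes>\<^bsub>A\<^esub> inv\<^bsub>A\<^esub> x y"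
    "\<And>v. v \<in> V \<Longrightarrow> v \<noteq> i0 \<Longrightarrow> p (x v) = x v"
    by (rule partial_conjugation[OF y(1) i0(1) y(2,3)]) (rule that)
  note closed = auto_closed[OF g] auto_closed[OF p(1)]
  have Mp: "M p i v = (if v = i then 1 else 0)" if "v \<in> V" for i v
    using that y i0 p(2) p(3)[of v] by (cases "v = i0") (auto simp: M_def)
  have ex_p: "ex i (p a) = ex i a" if "i \<in> V" "a \<in> carrier A" for i a
    using that fin by (simp add: ex_auto[OF p(1)] Mp if_distrib[of "\<lambda>u. u * _"] sum.delta cong: if_cong)
  have "\<not> (\<forall>a\<in>carrier A. p (g a) = w \<otimes>\<^bsub>A\<^esub> g (p a) \<otimes>\<^bsub>A\<^esub> inv\<^bsub>A\<^esub> w)"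
    if w: "w \<in> carrier A" for w
  proof
    assume conj: "\<forall>a\<in>carrier A. p (g a) = w \<otimes>\<^bsub>A\<^esub> g (p a) \<otimes>\<^bsub>A\<^esub> inv\<^bsub>A\<^esub> w"
    obtain m where m: "\<And>a b. a \<in> carrier A \<Longrightarrow> b \<in> carrier A \<Longrightarrow>
        m (a \<otimes>\<^bsub>A\<^esub> b) = m a + m b + ex y a * ex i0 b" "\<And>v. v \<in> V \<Longrightarrow> m (x v) = (0::int)"
      by (rule magnus_coefficient[of y i0]) (use y in \<open>auto simp: E_def\<close>)
    obtain n where n: "\<And>a b. a \<in> carrier A \<Longrightarrow> b \<in> carrier A \<Longrightarrow>
        n (a \<otimes>\<^bsub>A\<^esub> b) = n a + n b + ex y a * ex z b" "\<And>v. v \<in> V \<Longrightarrow> n (x v) = (0::int)"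
      by (rule magnus_coefficient[of y z]) (use y z in \<open>auto simp: E_def\<close>)
    \<comment> \<open>\<open>g\<close> negates both exponents in the quadratic term of
      \<open>m\<close> and so preserves it; hence \<open>d\<close> is additive.\<close>
    define d where "d a = m (g a) - m a" for a
    have d_add: "d (a \<otimes>\<^bsub>A\<^esub> b) = d a + d b" if "a \<in> carrier A" "b \<in> carrier A" for a b
      using that y i0 by (simp add: d_def auto_mult[OF g] m(1) closed neg)
    \<comment> \<open>\<open>p\<close> acts trivially on the abelianization, through which
      \<open>d\<close> factors.\<close>
    have d_p: "d (p a) = d a" if "a \<in> carrier A" for a
      using additive_eq_sum[OF fin d_add that] additive_eq_sum[OF fin d_add closed(2)[OF that]]
      by (simp add: ex_p[OF _ that])
    \<comment> \<open>\<open>p\<close> preserves exponents, so the difference is additive; among the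
      generators only \<open>x i0\<close> contributes.\<close>
    have m_p: "m (p a) = m a + ex i0 a" if a: "a \<in> carrier A" for a
    proof -
      have "m (p a) - m a = (\<Sum>v\<in>V. (m (p (x v)) - m (x v)) * ex v a)"
        using y i0 by (intro additive_eq_sum[OF fin _ a, of "\<lambda>a. m (p a) - m a"])
          (simp add: auto_mult[OF p(1)] m(1) closed ex_p)
      also have "\<dots> = (\<Sum>v\<in>V. if v = i0 then ex v a else 0)"
      proof (rule sum.cong[OF HOL.refl])
        fix v assume v: "v \<in> V"
        have "m (p (x i0)) = 1"
          using magnus_conj[where m = m, OF m(1), of "x y" "x i0"] y i0 by (simp add: p(2) m(2))
        thus "(m (p (x v)) - m (x v)) * ex v a = (if v = i0 then ex v a else 0)"
          using v p(3)[of v] by (simp add: m(2))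
      qed
      finally show ?thesis using fin i0 by simp
    qed
    have n_p: "n (p a) = n a" if a: "a \<in> carrier A" for a
    proof -
      have "n (p a) - n a = (\<Sum>v\<in>V. (n (p (x v)) - n (x v)) * ex v a)"
        using y z by (intro additive_eq_sum[OF fin _ a, of "\<lambda>a. n (p a) - n a"])
          (simp add: auto_mult[OF p(1)] n(1) closed ex_p)
      also have "\<dots> = 0"
      proof (rule sum.neutral, rule ballI)
        fix v assume v: "v \<in> V"
        have "n (p (x i0)) = 0"
          using magnus_conj[where m = n, OF n(1), of "x y" "x i0"] y z i0 by (simp add: p(2) n(2))
        thus "(n (p (x v)) - n (x v)) * ex v a = 0"
          using v p(3)[of v] by (cases "v = i0") (simp_all add: n(2))
      qed
      finally show ?thesis by simp
    qed
    have "m (p (g (x i0))) = d (x i0) - 1"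
      using i0 by (simp add: m_p closed neg d_def m(2))
    moreover have "m (p (g (x i0))) = m (g (p (x i0))) - ex y w"
      using magnus_conj[where m = m, OF m(1) w closed(1)[OF closed(2)[of "x i0"]]] conj i0 y
      by (simp add: closed neg ex_p)
    moreover have "m (g (p (x i0))) = 1 + d (x i0)"
      using d_p[of "x i0"] i0 by (simp add: d_def m_p m(2))
    moreover have "n (p (g (x z))) = n (g (p (x z))) - ex y w"
      using magnus_conj[where m = n, OF n(1) w closed(1)[OF closed(2)[of "x z"]]] conj z y
      by (simp add: closed neg ex_p)
    moreover have "n (p (g (x z))) = n (g (p (x z)))"
      using z by (simp add: n_p closed p(3))
    ultimately show False by simp
  qed
  thus ?thesis using that[OF p(1)] Mp by auto
qed

subsection \<open>Distinct twists differ by an outer automorphism\<close>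

text \<open>Agreement at \<open>i0\<close> fixes the common sign left open by \<open>g\<close>: it
  forces \<open>M g t t = 1\<close>.\<close>

lemma twist_separation:
  assumes c: "c (blk t) = 1" "\<And>k. c k = 1 \<or> c k = - 1"
    and c': "c' (blk t) = 1" "\<And>k. c' k = 1 \<or> c' k = - 1"
    and i0: "i0 \<in> V" "i0 \<noteq> t" "c (blk i0) = c' (blk i0)"
    and g: "g \<in> auto A"
    and conj: "\<And>f. f \<in> auto A \<Longrightarrow> \<exists>w\<in>carrier A. \<forall>a\<in>carrier A.
      twist c f (g a) = w \<otimes>\<^bsub>A\<^esub> g (twist c' f a) \<otimes>\<^bsub>A\<^esub> inv\<^bsub>A\<^esub> w"
    and i: "i \<in> V" "i \<noteq> t"
  shows "c (blk i) = c' (blk i)"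
proof -
  let ?e = "M g t t"
  have e: "?e = 1 \<or> ?e = - 1" by (rule auto_xt(2)[OF g])
  \<comment> \<open>Take the exponent of \<open>t\<close> in the conjugacy for the transvection of
    \<open>i\<close>: \<open>w\<close> contributes nothing, and \<open>ex t (g a)\<close> occurs on
    both sides.\<close>
  have ex_g: "ex i (g a) = ?e * c (blk i) * c' (blk i) * ex i a"
    if i: "i \<in> V" "i \<noteq> t" and a: "a \<in> carrier A" for i a
  proof -
    obtain w where w: "w \<in> carrier A" and h: "\<forall>a\<in>carrier A. twist c (transvection i) (g a)
        = w \<otimes>\<^bsub>A\<^esub> g (twist c' (transvection i) a) \<otimes>\<^bsub>A\<^esub> inv\<^bsub>A\<^esub> w"
      using conj[OF transvection_auto[OF i(2)]] by blast
    have "g a \<otimes>\<^bsub>A\<^esub> pw (c (blk i) * ex i (g a))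
        = w \<otimes>\<^bsub>A\<^esub> g (a \<otimes>\<^bsub>A\<^esub> pw (c' (blk i) * ex i a)) \<otimes>\<^bsub>A\<^esub> inv\<^bsub>A\<^esub> w"
      using bspec[OF h a] a i auto_closed[OF g a]
      by (simp add: twist_transvection[where c = c, OF c(1)] twist_transvection[where c = c', OF c'(1)])
    from arg_cong[OF this, of "ex t"]
    have "c (blk i) * ex i (g a) = ?e * (c' (blk i) * ex i a)"
      using a w auto_closed[OF g a] by (simp add: auto_mult[OF g] auto_pw[OF g])
    hence "c (blk i) * (c (blk i) * ex i (g a)) = c (blk i) * (?e * (c' (blk i) * ex i a))"
      by simp
    thus ?thesis using c(2)[of "blk i"] by auto
  qed
  \<comment> \<open>Otherwise \<open>g\<close> negates the abelianization of the block of
    \<open>i\<close>. The \<open>p\<close> of \<open>inversion_not_central\<close> is fixed by both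
    twists, so \<open>g\<close> would commute with it up to an inner automorphism.\<close>
  have one: "?e * c (blk i) * c' (blk i) = 1" if i: "i \<in> V" "i \<noteq> t" for i
  proof (rule ccontr)
    assume "?e * c (blk i) * c' (blk i) \<noteq> 1"
    hence s: "?e * c (blk i) * c' (blk i) = - 1"
      using e c(2)[of "blk i"] c'(2)[of "blk i"] by auto
    have neg: "ex j (g a) = - ex j a" if "blk j = blk i" "j \<in> V" "a \<in> carrier A" for j a
    proof -
      have "j \<noteq> t" using that i blk_t by metis
      thus ?thesis using ex_g[of j a] that s by simp
    qed
    obtain p where p: "p \<in> auto A" "\<And>v. v \<in> V \<Longrightarrow> v \<noteq> t \<Longrightarrow> M p t v = 0"
      "\<not> (\<exists>w\<in>carrier A. \<forall>a\<in>carrier A. p (g a) = w \<otimes>\<^bsub>A\<^esub> g (p a) \<otimes>\<^bsub>A\<^esub> inv\<^bsub>A\<^esub> w)"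
      by (rule inversion_not_central[OF g i neg]) (assumption+, rule that)
    show False
      using conj[OF p(1)] p(3) twist_fixed[where c = c, OF c(1) p(1,2)]
        twist_fixed[where c = c', OF c'(1) p(1,2)] by simp
  qed
  show ?thesis
    using one[OF i] one[OF i0(1,2)] i0(3) e c(2)[of "blk i0"] c(2)[of "blk i"] c'(2)[of "blk i"] by auto
qed

text \<open>Each \<open>k\<close> in \<open>K\<close> gives the signs that flip only block
  \<open>k\<close>. The block of \<open>v0\<close> is left out so that all of them agree there, as
  \<open>twist_separation\<close> requires.\<close>

theorem Out_Out_RAAG_large:
  assumes v0: "v0 \<in> V" "v0 \<noteq> t" and K: "K \<subseteq> blk ` (V - {t}) - {blk v0}"
  shows "infinite (carrier (OutGroup (OutGroup A))) \<or>
    card K \<le> card (carrier (OutGroup (OutGroup A)))"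
proof -
  define c where "c k = (\<lambda>b. if b = k then - 1 else 1 :: int)" for k :: 'k
  have c: "c k b = 1 \<or> c k b = - 1" "c k b * c k b = 1" for k b
    by (auto simp: c_def)
  have ct: "c k (blk t) = 1" if "k \<in> K" for k
    using that K blk_t by (auto simp: c_def)
  show ?thesis
  proof (rule A.OutGroup_OutGroup_large[where \<Phi> = "\<lambda>k. twist (c k)"])
    fix k assume k: "k \<in> K"
    show "twist (c k) \<in> hom (AutoGroup A) (AutoGroup A)"
      using ct[OF k] by (intro homI) (simp_all add: twist_auto twist_compose)
    show "bij_betw (twist (c k)) (auto A) (auto A)"
      using ct[OF k] c(2)
      by (intro bij_betw_byWitness[where f' = "twist (c k)"]) (auto simp: twist_auto twist_twist)
    show "twist (c k) f = f" if "f \<in> inner_auts A" for f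
      using twist_inner[where c = "c k", OF ct[OF k] that] .
  next
    fix k l g
    assume k: "k \<in> K" and l: "l \<in> K" and g: "g \<in> auto A"
      and conj: "\<And>f. f \<in> auto A \<Longrightarrow> \<exists>w\<in>carrier A. \<forall>a\<in>carrier A.
        twist (c k) f (g a) = w \<otimes>\<^bsub>A\<^esub> g (twist (c l) f a) \<otimes>\<^bsub>A\<^esub> inv\<^bsub>A\<^esub> w"
    obtain i where i: "i \<in> V" "i \<noteq> t" "k = blk i" using k K by auto
    have "c k (blk v0) = c l (blk v0)" using k l K by (auto simp: c_def)
    hence "c k (blk i) = c l (blk i)"
      using twist_separation[where c = "c k" and c' = "c l", OF ct[OF k] c(1) ct[OF l] c(1) v0 _ g conj i(1,2)]
      by simp
    thus "k = l" using i(3) by (auto simp: c_def split: if_splits)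
  qed
qed

end

section \<open>A graph with enough blocks for a given \<open>N\<close>\<close>

theorem theoremB:
  fixes N :: nat
  shows "\<exists>(V :: nat set) E. simplicial_graph V E \<and>
           (infinite (carrier (OutGroup (OutGroup (RAAG V E)))) \<or>
            card (carrier (OutGroup (OutGroup (RAAG V E)))) > N)"
proof -
  \<comment> \<open>Block 0 consists of \<open>t\<close> alone; the blocks 1 to \<open>N + 2\<close>
    get the distinct sizes 3 to \<open>N + 4\<close>.\<close>
  define size where "size k = (if k = 0 then 1 else k + 2)" for k :: nat
  define V where "V = prod_encode ` (SIGMA k:{..N + 2}. {..<size k})"
  define blk where "blk v = fst (prod_decode v)" for v
  define t where "t = prod_encode (0, 0)"
  have block: "{u \<in> V. blk u = k} = (\<lambda>j. prod_encode (k, j)) ` {..<size k}" if "k \<le> N + 2" for k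
    using that by (auto simp: V_def blk_def)
  have card_blk: "card {u \<in> V. blk u = k} = size k" if "k \<le> N + 2" for k
    unfolding block[OF that] by (subst card_image) (auto simp: inj_on_def)
  have blk_le: "blk v \<le> N + 2" if "v \<in> V" for v
    using that by (auto simp: V_def blk_def)
  have rep: "prod_encode (k, 0) \<in> V" "blk (prod_encode (k, 0)) = k" if "k \<le> N + 2" for k
    using that by (auto simp: V_def blk_def size_def)
  have t: "blk t = 0" by (simp add: t_def blk_def)
  have blk_0: "v = t" if "v \<in> V" "blk v = 0" for v
    using that by (auto simp: V_def blk_def t_def size_def)
  interpret cone_multipartite V blk t
  proof
    show "finite V" by (simp add: V_def)
    show "t \<in> V" using rep(1)[of 0] by (simp add: t_def)
    show "v = t" if "v \<in> V" "blk v = blk t" for v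
      using blk_0[OF that(1)] that(2) t by simp
    show "3 \<le> card {u \<in> V. blk u = blk v}" if "v \<in> V" "v \<noteq> t" for v
    proof -
      have "blk v \<noteq> 0" using blk_0[OF that(1)] that(2) by metis
      thus ?thesis unfolding card_blk[OF blk_le[OF that(1)]] by (simp add: size_def)
    qed
    show "blk v = blk w"
      if "v \<in> V" "w \<in> V" "card {u \<in> V. blk u = blk v} = card {u \<in> V. blk u = blk w}" for v w
    proof -
      have "size (blk v) = size (blk w)"
        using that(3) unfolding card_blk[OF blk_le[OF that(1)]] card_blk[OF blk_le[OF that(2)]] .
      thus ?thesis by (simp add: size_def split: if_splits)
    qed
  qed
  \<comment> \<open>Block 1 serves as the reference block, which leaves the \<open>N + 1\<close>
    blocks 2 to \<open>N + 2\<close> for \<open>K\<close>.\<close>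
  define v0 where "v0 = prod_encode (1 :: nat, 0 :: nat)"
  have v0: "v0 \<in> V" "blk v0 = 1" using rep[of 1] by (simp_all add: v0_def)
  hence "v0 \<noteq> t" using t by auto
  have "{2..N + 2} \<subseteq> blk ` (V - {t}) - {blk v0}"
  proof
    fix k assume k: "k \<in> {2..N + 2}"
    hence r: "prod_encode (k, 0) \<in> V" "blk (prod_encode (k, 0)) = k"
      using rep[of k] by auto
    hence "prod_encode (k, 0) \<noteq> t" using k t by auto
    thus "k \<in> blk ` (V - {t}) - {blk v0}"
      using k v0 r imageI[of "prod_encode (k, 0)" "V - {t}" blk] by simp
  qed
  from Out_Out_RAAG_large[OF v0(1) \<open>v0 \<noteq> t\<close> this]
  have "infinite (carrier (OutGroup (OutGroup A))) \<or> N < card (carrier (OutGroup (OutGroup A)))"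
    by (simp add: Suc_le_eq)
  with simplicial show ?thesis by blast
qed

end
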